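(* For infinitely many positive integers $t$, there exists an adaptive $t$-function dictatorship test that makes $t+\log_2(t+1)$ queries, has completeness $1$, and has soundness $\frac{(t+1)^{2}}{2^{t}}$.
   Context: All vectors lie in $\{0,1\}^n$ with coordinatewise addition mod $2$; $\vec 1$ is the all-ones vector; for $v\in\{0,1\}^n$, $|v|=\sum_i v_i$, and $v$ is identified with the subset $\{i: v_i=1\}\subseteq[n]$. For $f:\{0,1\}^n\to\mathbb{R}$ and $\alpha\in\{0,1\}^n$, $\widehat f(\alpha)=\mathbb{E}_{x}f(x)\chi_\alpha(x)$ with $\chi_\alpha(x)=(-1)^{\sum_i\alpha_ix_i}$ ($x$ uniform). For an integer $0\le w\le n$, the degree-$w$ influence of variable $i$ is $I_i^{\le w}(f)=\sum_{\alpha:\alpha_i=1,|\alpha|\le w}\widehat f(\alpha)^2$. The $i$-th dictator is $f(x)=(-1)^{x_i}$. Folding convention: all functions are accessed in folded form, i.e. to obtain the value at $x$ with $x_1=0$ the test queries the point $\vec 1+x$ and negates the answer; equivalently every function $f$ is assumed to satisfy $f(\vec1+x)=-f(x)$ (so $\mathbb{E}f=0$). A test $T$ is a $t$-function dictatorship test with completeness $c$ and soundness $s$ if it has oracle access to $f_1,\dots,f_t:\{0,1\}^n\to\{-1,1\}$ and: (i) if there is $i\in[n]$ with $f_a(x)=(-1)^{x_i}$ for all $a\in[t]$, then $T$ accepts with probability at least $c$; (ii) for every $\epsilon>0$ there exist a constant $\tau>0$ and a fixed positive integer $w$ such that whenever $T$ accepts with probability at least $s+\epsilon$, there exist $a\neq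 b\in[t]$ and $i\in[n]$ with $I_i^{\le w}(f_a)\ge\tau$ and $I_i^{\le w}(f_b)\ge\tau$. The number of queries is the total number of function evaluations; "adaptive" means later query points may depend on answers to earlier queries. *)

theory Defs
  imports "HOL-Probability.Probability_Mass_Function"
begin

text \<open>Vectors of \<open>{0,1}^n\<close> are extensional functions on \<open>{1..n}\<close> with values \<open>0, 1 :: nat\<close>;
  the dimension \<open>n\<close> is an ordinary argument, since a test is one object for all \<open>n\<close>.\<close>

type_synonym vec = "nat \<Rightarrow> nat"

definition cube :: "nat \<Rightarrow> vec set" where
  "cube n = {1..n} \<rightarrow>\<^sub>E {0, 1}"

definition vadd :: "nat \<Rightarrow> vec \<Rightarrow> vec \<Rightarrow> vec" where
  "vadd n x y = (\<lambda>i\<in>{1..n}. (x i + y i) mod 2)"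

definition ones :: "nat \<Rightarrow> vec" where
  "ones n = (\<lambda>i\<in>{1..n}. 1)"

definition weight :: "nat \<Rightarrow> vec \<Rightarrow> nat" where
  "weight n v = (\<Sum>i=1..n. v i)"

definition chi :: "nat \<Rightarrow> vec \<Rightarrow> vec \<Rightarrow> real" where
  "chi n \<alpha> x = (- 1) ^ (\<Sum>i=1..n. \<alpha> i * x i)"

definition fourier :: "nat \<Rightarrow> (vec \<Rightarrow> real) \<Rightarrow> vec \<Rightarrow> real" where
  "fourier n f \<alpha> = (\<Sum>x\<in>cube n. f x * chi n \<alpha> x) / real (card (cube n))"

text \<open>The argument \<open>w\<close> is an arbitrary natural number, so that the same \<open>w\<close> makes sense for every \<open>n\<close>;
  for \<open>w \<ge> n\<close> this is the degree-\<open>n\<close> influence.\<close>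

definition low_influence :: "nat \<Rightarrow> nat \<Rightarrow> nat \<Rightarrow> (vec \<Rightarrow> real) \<Rightarrow> real" where
  "low_influence n w i f =
     (\<Sum>\<alpha> | \<alpha> \<in> cube n \<and> \<alpha> i = 1 \<and> weight n \<alpha> \<le> w. (fourier n f \<alpha>)\<^sup>2)"

definition dictator :: "nat \<Rightarrow> vec \<Rightarrow> real" where
  "dictator i x = (- 1) ^ x i"

definition folded :: "nat \<Rightarrow> (vec \<Rightarrow> real) \<Rightarrow> bool" where
  "folded n f \<longleftrightarrow> (\<forall>x\<in>cube n. f (vadd n (ones n) x) = - f x)"

definition oracles :: "nat \<Rightarrow> nat \<Rightarrow> (nat \<Rightarrow> vec \<Rightarrow> real) \<Rightarrow> bool" where
  "oracles n t f \<longleftrightarrow> (\<forall>a\<in>{1..t}. f a \<in> cube n \<rightarrow> {- 1, 1} \<and> folded n (f a))"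

text \<open>A deterministic adaptive procedure is a decision tree. \<open>Query a x T U\<close> evaluates \<open>f a\<close> at \<open>x\<close>
  and continues with \<open>T\<close> on answer \<open>1\<close> and with \<open>U\<close> on answer \<open>- 1\<close>. A randomized procedure is a
  distribution over such trees.\<close>

datatype tree = Verdict bool | Query nat vec tree tree

primrec accepts :: "(nat \<Rightarrow> vec \<Rightarrow> real) \<Rightarrow> tree \<Rightarrow> bool" where
  "accepts f (Verdict b) = b"
| "accepts f (Query a x T U) = (if f a x = 1 then accepts f T else accepts f U)"

primrec wf_tree :: "nat \<Rightarrow> nat \<Rightarrow> tree \<Rightarrow> bool" where
  "wf_tree n t (Verdict b) = True"
| "wf_tree n t (Query a x T U) = (a \<in> {1..t} \<and> x \<in> cube n \<and> wf_tree n t T \<and> wf_tree n t U)"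

text \<open>Every computation path evaluates the oracles exactly \<open>q\<close> times, repetitions included.\<close>

primrec tree_queries :: "tree \<Rightarrow> nat \<Rightarrow> bool" where
  "tree_queries (Verdict b) q = (q = 0)"
| "tree_queries (Query a x T U) q =
     (q > 0 \<and> tree_queries T (q - 1) \<and> tree_queries U (q - 1))"

definition accept_prob :: "tree pmf \<Rightarrow> (nat \<Rightarrow> vec \<Rightarrow> real) \<Rightarrow> real" where
  "accept_prob D f = measure_pmf.prob D {T. accepts f T}"

text \<open>A test is a family \<open>D\<close> with one randomized procedure \<open>D n\<close> for each dimension \<open>n \<ge> 1\<close>.\<close>

definition makes_queries :: "(nat \<Rightarrow> tree pmf) \<Rightarrow> nat \<Rightarrow> bool" where
  "makes_queries D q \<longleftrightarrow> (\<forall>n\<ge>1. \<forall>T\<in>set_pmf (D n). tree_queries T q)"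

definition has_completeness :: "nat \<Rightarrow> (nat \<Rightarrow> tree pmf) \<Rightarrow> real \<Rightarrow> bool" where
  "has_completeness t D c \<longleftrightarrow>
     (\<forall>n\<ge>1. \<forall>f. oracles n t f \<longrightarrow>
        (\<exists>i\<in>{1..n}. \<forall>a\<in>{1..t}. \<forall>x\<in>cube n. f a x = dictator i x) \<longrightarrow>
        accept_prob (D n) f \<ge> c)"

text \<open>The constants \<open>\<tau>\<close> and \<open>w\<close> may depend on \<open>\<epsilon>\<close> and on the test, but not on \<open>n\<close>.\<close>

definition has_soundness :: "nat \<Rightarrow> (nat \<Rightarrow> tree pmf) \<Rightarrow> real \<Rightarrow> bool" where
  "has_soundness t D s \<longleftrightarrow>
     (\<forall>\<epsilon>>0. \<exists>\<tau>>0. \<exists>w\<ge>1. \<forall>n\<ge>1. \<forall>f. oracles n t f \<longrightarrow>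
        accept_prob (D n) f \<ge> s + \<epsilon> \<longrightarrow>
        (\<exists>a\<in>{1..t}. \<exists>b\<in>{1..t}. \<exists>i\<in>{1..n}. a \<noteq> b \<and>
           low_influence n w i (f a) \<ge> \<tau> \<and> low_influence n w i (f b) \<ge> \<tau>))"

definition dictatorship_test :: "nat \<Rightarrow> real \<Rightarrow> real \<Rightarrow> (nat \<Rightarrow> tree pmf) \<Rightarrow> bool" where
  "dictatorship_test t c s D \<longleftrightarrow>
     (\<forall>n\<ge>1. \<forall>T\<in>set_pmf (D n). wf_tree n t T) \<and> has_completeness t D c \<and> has_soundness t D s"

end

theory Submission imports Defs "HOL-Analysis.Convex" begin

text \<open>Let \<open>t = 2\<^sup>k - 1\<close> and let \<open>C\<close> be the Hadamard code of length \<open>t\<close> with \<open>2\<^sup>k\<close> words, whose letters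
  are pairwise independent. From the answer to \<open>f 1 y\<close> with \<open>y\<close> uniform one gets
  \<open>v \<in> {y, y + 1}\<close> vanishing at the coordinate of the dictator. Where \<open>v j = 0\<close>, coordinate \<open>j\<close> of the
  point queried in \<open>f a\<close> is letter \<open>a\<close> of a random codeword; where \<open>v j = 1\<close> it is an independent bit.
  The test accepts iff the answers form a codeword, as they always do for a dictator.

  For soundness, a union bound over the two answers to \<open>f 1 y\<close> costs a factor \<open>2\<close> and makes \<open>v\<close>
  uniform; it remains to see that the answers are then nearly uniform, so that acceptance has
  probability about \<open>2 \<cdot> 2\<^sup>k / 2\<^sup>t\<close>. Make the query points independent one coordinate at a time. By pairwise
  independence only products of at least three discrete derivatives contribute to the error, and
  Cauchy-Schwarz bounds it by the square root of a product of three influences. The coordinates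
  with \<open>v j = 1\<close> act as noise, so the influences of each function have bounded sum. If no two
  functions share an influential variable, at least two of the three influences are small at every
  coordinate, and the total error is small.\<close>

subsection \<open>Uniform averages\<close>

definition mean :: "'a set \<Rightarrow> ('a \<Rightarrow> real) \<Rightarrow> real" where
  "mean A f = (\<Sum>x\<in>A. f x) / real (card A)"

lemma mean_cong: "(\<And>x. x \<in> A \<Longrightarrow> f x = g x) \<Longrightarrow> mean A f = mean A g"
  by (simp add: mean_def)

lemma mean_add: "mean A (\<lambda>x. f x + g x) = mean A f + mean A g"
  by (simp add: mean_def sum.distrib add_divide_distrib)

lemma mean_diff: "mean A (\<lambda>x. f x - g x) = mean A f - mean A g"
  by (simp add: mean_def sum_subtractf diff_divide_distrib)

lemma mean_cmult: "mean A (\<lambda>x. c * f x) = c * mean A f"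
  by (simp add: mean_def sum_distrib_left)

lemma mean_divide: "mean A (\<lambda>x. f x / c) = mean A f / c"
  using mean_cmult[of A "1 / c" f] by simp

lemma mean_const: "finite A \<Longrightarrow> A \<noteq> {} \<Longrightarrow> mean A (\<lambda>x. c) = c"
  by (simp add: mean_def)

lemma mean_sum: "mean A (\<lambda>x. \<Sum>i\<in>B. f i x) = (\<Sum>i\<in>B. mean A (f i))"
  unfolding mean_def by (subst sum.swap) (simp add: sum_divide_distrib)

lemma mean_swap: "mean A (\<lambda>x. mean B (f x)) = mean B (\<lambda>y. mean A (\<lambda>x. f x y))"
  by (simp add: mean_def sum_divide_distrib) (subst sum.swap, simp add: mult.commute)

lemma mean_mono: "(\<And>x. x \<in> A \<Longrightarrow> f x \<le> g x) \<Longrightarrow> mean A f \<le> mean A g"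
  by (simp add: mean_def divide_right_mono sum_mono)

lemma abs_mean_le: "\<bar>mean A f\<bar> \<le> mean A (\<lambda>x. \<bar>f x\<bar>)"
  by (simp add: mean_def divide_right_mono)

lemma mean_Cauchy_Schwarz: "(mean A (\<lambda>x. f x * g x))\<^sup>2 \<le> mean A (\<lambda>x. (f x)\<^sup>2) * mean A (\<lambda>x. (g x)\<^sup>2)"
proof -
  have "(\<Sum>x\<in>A. f x * g x)\<^sup>2 \<le> (\<Sum>x\<in>A. (f x)\<^sup>2) * (\<Sum>x\<in>A. (g x)\<^sup>2)"
    by (rule Cauchy_Schwarz_ineq_sum)
  then show ?thesis
    by (simp add: mean_def power_divide power2_eq_square divide_right_mono)
qed

lemma mean_two: "mean {0, Suc 0} f = (f 0 + f (Suc 0)) / 2"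
  by (simp add: mean_def)

lemma mean_bij_betw:
  assumes "bij_betw h A B"
  shows "mean A (\<lambda>x. f (h x)) = mean B f"
  using sum.reindex_bij_betw[OF assms, of f] bij_betw_same_card[OF assms] by (simp add: mean_def)

lemma mean_Times: "mean (A \<times> B) f = mean A (\<lambda>x. mean B (\<lambda>y. f (x, y)))"
  by (simp add: mean_def sum.cartesian_product card_cartesian_product flip: sum_divide_distrib)

text \<open>Fubini for one coordinate; all inductions on the set of coordinates start from
  it.\<close>

lemma mean_PiE_insert:
  assumes "n \<notin> I"
  shows "mean (PiE (insert n I) A) f = mean (A n) (\<lambda>a. mean (PiE I A) (\<lambda>x. f (x(n := a))))"
proof -
  have "bij_betw (\<lambda>(y, g). g(n := y)) (A n \<times> PiE I A) (PiE (insert n I) A)"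
    unfolding bij_betw_def PiE_insert_eq using inj_combinator[OF assms, of A] by simp
  from mean_bij_betw[OF this, of f] show ?thesis
    by (simp add: mean_Times case_prod_unfold)
qed

lemma mean_prod_PiE:
  assumes "finite T" "\<And>a. a \<in> T \<Longrightarrow> finite (B a)"
  shows "mean (PiE T B) (\<lambda>z. \<Prod>a\<in>T. g a (z a)) = (\<Prod>a\<in>T. mean (B a) (g a))"
  using prod_sum_PiE[OF assms(1), of B g] assms
  by (simp add: mean_def prod_dividef card_PiE flip: of_nat_prod)

subsection \<open>Fourier coefficients and noisy influences\<close>

abbreviation bits :: "nat set \<Rightarrow> vec set" where
  "bits I \<equiv> PiE I (\<lambda>_. {0, Suc 0})"

text \<open>This is \<open>fourier\<close> over an arbitrary index set instead of
  \<open>{1..n}\<close>, so that coordinates can be removed one by one.\<close>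

definition coef :: "nat set \<Rightarrow> (vec \<Rightarrow> real) \<Rightarrow> vec \<Rightarrow> real" where
  "coef I f \<alpha> = mean (bits I) (\<lambda>x. f x * (- 1) ^ (\<Sum>i\<in>I. \<alpha> i * x i))"

definition size_of :: "nat set \<Rightarrow> vec \<Rightarrow> nat" where
  "size_of I \<alpha> = (\<Sum>i\<in>I. \<alpha> i)"

text \<open>Any noise rate at least \<open>1 / sqrt 2\<close> and below \<open>1\<close> would do; the lower bound is needed in
  \<open>influence_step\<close>, where two of three factors are correlated.\<close>

definition ninf :: "nat set \<Rightarrow> nat \<Rightarrow> (vec \<Rightarrow> real) \<Rightarrow> real" where
  "ninf I j f = (\<Sum>\<alpha> | \<alpha> \<in> bits I \<and> \<alpha> j = Suc 0. (3 / 4) ^ size_of I \<alpha> * (coef I f \<alpha>)\<^sup>2)"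

text \<open>\<open>f (x(n := 0))\<close> and \<open>f (x(n := Suc 0))\<close> are even part plus and
  minus odd part. Since \<open>x n\<close> is overwritten, both parts of a function on
  \<open>bits (insert n I)\<close> can be used on \<open>bits I\<close>.\<close>

definition even_part :: "nat \<Rightarrow> (vec \<Rightarrow> real) \<Rightarrow> vec \<Rightarrow> real" where
  "even_part n f x = (f (x(n := 0)) + f (x(n := Suc 0))) / 2"

definition odd_part :: "nat \<Rightarrow> (vec \<Rightarrow> real) \<Rightarrow> vec \<Rightarrow> real" where
  "odd_part n f x = (f (x(n := 0)) - f (x(n := Suc 0))) / 2"

section \<open>Splitting off one coordinate\<close>

lemma finite_bits: "finite I \<Longrightarrow> finite (bits I)"
  by (intro finite_PiE) auto

lemma bits_nonempty: "bits I \<noteq> {}"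
  by (simp add: PiE_eq_empty_iff)

lemma sum_fun_upd_out:
  assumes "n \<notin> I"
  shows "(\<Sum>i\<in>I. (\<alpha>(n := a)) i * (x(n := b)) i) = (\<Sum>i\<in>I. \<alpha> i * x i :: nat)"
  using assms by (intro sum.cong) auto

text \<open>A character with exponent \<open>0\<close> at \<open>n\<close> ignores that coordinate,
  so averaging over it leaves the even part. With exponent \<open>1\<close>, in the next lemma, the
  sign leaves the odd part.\<close>

lemma coef_insert_0:
  assumes "finite I" "n \<notin> I"
  shows "coef (insert n I) f (\<alpha>(n := 0)) = coef I (even_part n f) \<alpha>"
  using assms unfolding coef_def
  by (simp add: mean_PiE_insert mean_two sum_fun_upd_out del: fun_upd_apply)
     (simp add: mean_two even_part_def add_divide_distrib distrib_right mean_add mean_divide)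

lemma coef_insert_1:
  assumes "finite I" "n \<notin> I"
  shows "coef (insert n I) f (\<alpha>(n := Suc 0)) = coef I (odd_part n f) \<alpha>"
  using assms unfolding coef_def
  by (simp add: mean_PiE_insert mean_two sum_fun_upd_out del: fun_upd_apply)
     (simp add: mean_two odd_part_def diff_divide_distrib left_diff_distrib mean_diff mean_divide
       mean_cmult[of _ "- 1", simplified])

lemma mean_bits_insert:
  assumes "n \<notin> I"
  shows "mean (bits (insert n I)) f = mean (bits I) (even_part n f)"
  using assms by (simp add: mean_PiE_insert mean_two even_part_def[abs_def] mean_add mean_divide add_divide_distrib)

lemma sum_bits_insert:
  assumes "finite I" "n \<notin> I"
  shows "(\<Sum>\<alpha>\<in>bits (insert n I). F \<alpha>) = (\<Sum>\<alpha>\<in>bits I. F (\<alpha>(n := 0)) + F (\<alpha>(n := Suc 0)) :: real)"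
  \<comment> \<open>A sum is a mean times the number of points, and \<open>bits (insert n I)\<close>
    has twice as many as \<open>bits I\<close>.\<close>
  using mean_PiE_insert[OF assms(2), of "\<lambda>_. {0, Suc 0}" F] assms
  by (simp add: mean_two card_PiE sum.distrib) (simp add: mean_def card_PiE field_simps)

lemma ninf_altdef:
  assumes "finite I"
  shows "ninf I j f = (\<Sum>\<alpha>\<in>bits I. if \<alpha> j = Suc 0 then (3 / 4) ^ size_of I \<alpha> * (coef I f \<alpha>)\<^sup>2 else 0)"
  unfolding ninf_def using sum.inter_filter[OF finite_bits[OF assms]] by simp

lemma size_of_insert:
  assumes "finite I" "n \<notin> I"
  shows "size_of (insert n I) (\<alpha>(n := b)) = b + size_of I \<alpha>"
proof -
  have "(\<Sum>i\<in>I. (\<alpha>(n := b)) i) = (\<Sum>i\<in>I. \<alpha> i)"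
    using assms by (intro sum.cong) auto
  then show ?thesis using assms by (simp add: size_of_def)
qed

text \<open>The even part carries the coefficients with \<open>\<alpha> n = 0\<close>, the odd part
  those with \<open>\<alpha> n = 1\<close>, whose degree is one higher; hence the extra
  \<open>3 / 4\<close>.\<close>

lemma ninf_insert:
  assumes "finite I" "n \<notin> I" "j \<in> I"
  shows "ninf (insert n I) j f = ninf I j (even_part n f) + 3 / 4 * ninf I j (odd_part n f)"
proof -
  have "j \<noteq> n" using assms by auto
  then show ?thesis
    using assms
    by (simp add: ninf_altdef sum_bits_insert size_of_insert coef_insert_0 coef_insert_1
        sum_distrib_left flip: sum.distrib)
       (intro sum.cong refl, simp add: size_of_insert coef_insert_0 coef_insert_1)
qed

lemma ninf_nonneg: "0 \<le> ninf I j f"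
  unfolding ninf_def by (intro sum_nonneg) auto

lemma coef_zero: "coef I f (\<lambda>i\<in>I. 0) = mean (bits I) f"
  by (simp add: coef_def)

text \<open>The mean of the odd part is the coefficient of \<open>f\<close> at the singleton
  \<open>n\<close>; the bound keeps only this term of the influence.\<close>

lemma ninf_insert_self:
  assumes "finite I" "n \<notin> I"
  shows "3 / 4 * (mean (bits I) (odd_part n f))\<^sup>2 \<le> ninf (insert n I) n f"
proof -
  have "3 / 4 * (mean (bits I) (odd_part n f))\<^sup>2
      = (3 / 4) * ((3 / 4) ^ size_of I (\<lambda>i\<in>I. 0) * (coef I (odd_part n f) (\<lambda>i\<in>I. 0))\<^sup>2)"
    by (simp add: coef_zero size_of_def)
  also have "\<dots> \<le> (3 / 4) * (\<Sum>\<alpha>\<in>bits I. (3 / 4) ^ size_of I \<alpha> * (coef I (odd_part n f) \<alpha>)\<^sup>2)"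
    using finite_bits[OF assms(1)] by (intro mult_left_mono member_le_sum) auto
  also have "\<dots> = ninf (insert n I) n f"
    using assms by (simp add: ninf_altdef sum_bits_insert size_of_insert
        coef_insert_1 sum_distrib_left mult.assoc)
  finally show ?thesis .
qed

lemma coef_add: "coef I (\<lambda>x. f x + g x) \<alpha> = coef I f \<alpha> + coef I g \<alpha>"
  by (simp add: coef_def distrib_right mean_add)

lemma coef_diff: "coef I (\<lambda>x. f x - g x) \<alpha> = coef I f \<alpha> - coef I g \<alpha>"
  by (simp add: coef_def left_diff_distrib mean_diff)

text \<open>Coefficients are linear and the two restrictions are even part plus or minus odd part,
  so this is the parallelogram identity in each term.\<close>

lemma ninf_parallelogram:
  assumes "finite I"
  shows "ninf I j (\<lambda>x. f (x(n := 0))) + ninf I j (\<lambda>x. f (x(n := Suc 0)))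
       = 2 * (ninf I j (even_part n f) + ninf I j (odd_part n f))"
proof -
  have "(\<lambda>x. f (x(n := 0))) = (\<lambda>x. even_part n f x + odd_part n f x)"
       "(\<lambda>x. f (x(n := Suc 0))) = (\<lambda>x. even_part n f x - odd_part n f x)"
    by (auto simp: even_part_def odd_part_def field_simps)
  then show ?thesis
    unfolding ninf_def
    by (simp add: coef_add coef_diff power2_sum power2_diff algebra_simps sum.distrib
        sum_subtractf sum_distrib_left)
qed

lemma Parseval:
  assumes "finite I"
  shows "(\<Sum>\<alpha>\<in>bits I. (coef I f \<alpha>)\<^sup>2) = mean (bits I) (\<lambda>x. (f x)\<^sup>2)"
  using assms
proof (induction I arbitrary: f)
  case empty
  then show ?case by (simp add: coef_def mean_def)
next
  case (insert n I)
  have "(\<Sum>\<alpha>\<in>bits (insert n I). (coef (insert n I) f \<alpha>)\<^sup>2)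
      = mean (bits I) (\<lambda>x. (even_part n f x)\<^sup>2 + (odd_part n f x)\<^sup>2)"
    using insert
    by (simp add: sum_bits_insert coef_insert_0 coef_insert_1 sum.distrib mean_add)
  also have "\<dots> = mean (bits I) (even_part n (\<lambda>x. (f x)\<^sup>2))"
    by (intro mean_cong) (simp add: even_part_def odd_part_def power2_eq_square field_simps)
  finally show ?case using insert by (simp add: mean_bits_insert)
qed

text \<open>Bernoulli's inequality for \<open>(4 / 3) ^ m\<close> gives
  \<open>m \<le> 3 * (4 / 3) ^ m\<close>.\<close>

lemma power_times_le_3: "real m * (3 / 4) ^ m \<le> 3"
proof -
  have "1 + real m * (1 / 3) \<le> (1 + 1 / 3) ^ m"
    by (rule Bernoulli_inequality) simp
  then have "real m \<le> 3 * (4 / 3) ^ m" by simp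
  then have "real m * (3 / 4) ^ m \<le> 3 * (4 / 3) ^ m * (3 / 4) ^ m"
    by (intro mult_right_mono) auto
  then show ?thesis by (simp add: power_mult_distrib[symmetric] mult.assoc)
qed

text \<open>Summing over \<open>j\<close> counts each character as often as its degree; the noise
  damps this count to at most \<open>3\<close>, and Parseval bounds the rest independently of the
  dimension.\<close>

lemma sum_ninf_le:
  assumes "finite I" and "\<And>x. x \<in> bits I \<Longrightarrow> \<bar>f x\<bar> \<le> 1"
  shows "(\<Sum>j\<in>I. ninf I j f) \<le> 3"
proof -
  have "(\<Sum>j\<in>I. ninf I j f)
      = (\<Sum>\<alpha>\<in>bits I. \<Sum>j\<in>I. real (\<alpha> j) * ((3 / 4) ^ size_of I \<alpha> * (coef I f \<alpha>)\<^sup>2))"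
    unfolding ninf_altdef[OF assms(1)]
    by (subst sum.swap) (intro sum.cong refl, auto)
  also have "\<dots> = (\<Sum>\<alpha>\<in>bits I. (real (size_of I \<alpha>) * (3 / 4) ^ size_of I \<alpha>) * (coef I f \<alpha>)\<^sup>2)"
    by (simp add: size_of_def mult.assoc sum_distrib_right)
  also have "\<dots> \<le> (\<Sum>\<alpha>\<in>bits I. 3 * (coef I f \<alpha>)\<^sup>2)"
    by (intro sum_mono mult_right_mono power_times_le_3) auto
  also have "\<dots> = 3 * mean (bits I) (\<lambda>x. (f x)\<^sup>2)"
    by (simp add: Parseval[OF assms(1)] flip: sum_distrib_left)
  also have "\<dots> \<le> 3 * mean (bits I) (\<lambda>x. 1)"
    using assms(2) by (intro mult_left_mono mean_mono) (auto simp: abs_square_le_1)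
  also have "\<dots> = 3"
    by (simp add: mean_const finite_bits[OF assms(1)] bits_nonempty)
  finally show ?thesis .
qed

text \<open>Up to degree \<open>w\<close> the noise factor is at most \<open>1\<close>. Beyond
  \<open>w\<close> it is at most \<open>(3 / 4) ^ w\<close>, which multiplies a total squared mass
  of at most \<open>1\<close>.\<close>

lemma ninf_le_low_degree:
  assumes "finite I" and "\<And>x. x \<in> bits I \<Longrightarrow> \<bar>f x\<bar> \<le> 1"
  shows "ninf I j f \<le> (\<Sum>\<alpha> | \<alpha> \<in> bits I \<and> \<alpha> j = Suc 0 \<and> size_of I \<alpha> \<le> w. (coef I f \<alpha>)\<^sup>2) + (3 / 4) ^ w"
proof -
  let ?c = "\<lambda>\<alpha>. (coef I f \<alpha>)\<^sup>2"
  have "ninf I j f \<le> (\<Sum>\<alpha>\<in>bits I. (if \<alpha> j = Suc 0 \<and> size_of I \<alpha> \<le> w then ?c \<alpha> else 0) + (3 / 4) ^ w * ?c \<alpha>)"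
    unfolding ninf_altdef[OF assms(1)]
  proof (intro sum_mono)
    fix \<alpha>
    have "(3 / 4) ^ size_of I \<alpha> * ?c \<alpha> \<le> 1 * ?c \<alpha>"
      by (intro mult_right_mono) (auto simp: power_le_one)
    moreover have "(3 / 4) ^ size_of I \<alpha> * ?c \<alpha> \<le> (3 / 4) ^ w * ?c \<alpha>" if "w \<le> size_of I \<alpha>"
      using that by (intro mult_right_mono power_decreasing) auto
    moreover have "0 \<le> (3 / 4) ^ w * ?c \<alpha>" by simp
    ultimately show "(if \<alpha> j = Suc 0 then (3 / 4) ^ size_of I \<alpha> * ?c \<alpha> else 0)
        \<le> (if \<alpha> j = Suc 0 \<and> size_of I \<alpha> \<le> w then ?c \<alpha> else 0) + (3 / 4) ^ w * ?c \<alpha>"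
      by (smt (verit) linorder_linear)
  qed
  also have "\<dots> = (\<Sum>\<alpha> | \<alpha> \<in> bits I \<and> \<alpha> j = Suc 0 \<and> size_of I \<alpha> \<le> w. ?c \<alpha>)
      + (3 / 4) ^ w * mean (bits I) (\<lambda>x. (f x)\<^sup>2)"
    using sum.inter_filter[OF finite_bits[OF assms(1)], of ?c "\<lambda>\<alpha>. \<alpha> j = Suc 0 \<and> size_of I \<alpha> \<le> w"]
    by (simp add: sum.distrib sum_distrib_left[symmetric] Parseval[OF assms(1)])
  also have "mean (bits I) (\<lambda>x. (f x)\<^sup>2) \<le> mean (bits I) (\<lambda>x. 1)"
    using assms(2) by (intro mean_mono) (auto simp: abs_square_le_1)
  finally show ?thesis
    by (simp add: mean_const finite_bits[OF assms(1)] bits_nonempty mult_left_mono)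
qed

subsection \<open>Invariance for pairwise independent points\<close>

text \<open>For bits, \<open>balanced\<close> and \<open>uncorrelated\<close> say exactly that the
  letters of a uniform codeword are unbiased and pairwise independent. Elements of \<open>C\<close>
  are names of codewords, with letters \<open>\<beta> c a\<close>.\<close>

locale sign_code =
  fixes T :: "nat set" and C :: "'c set" and \<beta> :: "'c \<Rightarrow> nat \<Rightarrow> nat"
  assumes finite_T: "finite T" and finite_C: "finite C" and C_nonempty: "C \<noteq> {}"
    and code_bit: "\<And>c a. c \<in> C \<Longrightarrow> a \<in> T \<Longrightarrow> \<beta> c a \<in> {0, Suc 0}"
    and balanced: "\<And>a. a \<in> T \<Longrightarrow> mean C (\<lambda>c. (- 1) ^ \<beta> c a) = 0"
    and uncorrelated: "\<And>a b. a \<in> T \<Longrightarrow> b \<in> T \<Longrightarrow> a \<noteq> b \<Longrightarrow>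
      mean C (\<lambda>c. (- 1) ^ \<beta> c a * (- 1) ^ \<beta> c b) = 0"
begin

text \<open>One coordinate \<open>j\<close> of all query points is drawn from a triple \<open>(v, c, z)\<close>: if \<open>v = 0\<close>, the
  point for \<open>f a\<close> gets letter \<open>a\<close> of the codeword \<open>c\<close>, otherwise the independent bit \<open>z a\<close>.\<close>

definition sample :: "(nat \<times> 'c \<times> vec) set" where
  "sample = {0, Suc 0} \<times> C \<times> bits T"

definition sample_bit :: "nat \<times> 'c \<times> vec \<Rightarrow> nat \<Rightarrow> nat" where
  "sample_bit s a = (case s of (v, c, z) \<Rightarrow> if v = 0 then \<beta> c a else z a)"

definition point :: "nat set \<Rightarrow> (nat \<Rightarrow> nat \<times> 'c \<times> vec) \<Rightarrow> nat \<Rightarrow> vec" where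
  "point I \<xi> a = (\<lambda>i\<in>I. sample_bit (\<xi> i) a)"

definition expect :: "nat set \<Rightarrow> ((nat \<Rightarrow> vec) \<Rightarrow> real) \<Rightarrow> real" where
  "expect I F = mean (PiE I (\<lambda>_. sample)) (\<lambda>\<xi>. F (point I \<xi>))"

definition triples :: "(nat \<times> nat \<times> nat) set" where
  "triples = {(a, b, c). a \<in> T \<and> b \<in> T \<and> c \<in> T \<and> a \<noteq> b \<and> a \<noteq> c \<and> b \<noteq> c}"

lemma finite_triples: "finite triples"
  by (rule finite_subset[of _ "T \<times> T \<times> T"]) (auto simp: triples_def finite_T)

text \<open>The first component is a fair coin choosing between codeword letters and independent
  bits.\<close>

lemma mean_sample: "mean sample (\<lambda>s. G (sample_bit s)) = (mean C (\<lambda>c. G (\<beta> c)) + mean (bits T) G) / 2"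
proof -
  have "sample_bit (0, c, z) = \<beta> c" "sample_bit (Suc 0, c, z) = z" for c z
    by (auto simp: sample_bit_def)
  then show ?thesis
    by (simp add: sample_def mean_Times mean_two mean_const finite_C C_nonempty
        finite_bits[OF finite_T] bits_nonempty del: PiE_eq_empty_iff)
qed

lemma expect_insert:
  assumes "n \<notin> I"
  shows "expect (insert n I) F
       = mean sample (\<lambda>s. expect I (\<lambda>q. F (\<lambda>a. (q a)(n := sample_bit s a))))"
proof -
  have "point (insert n I) (\<xi>(n := s)) = (\<lambda>a. (point I \<xi> a)(n := sample_bit s a))" for \<xi> s
    using assms by (intro ext) (auto simp: point_def)
  then show ?thesis
    by (simp add: expect_def mean_PiE_insert[OF assms])
qed

text \<open>Fourier expansion of a function of a single bit.\<close>

lemma code_split: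
  assumes "c \<in> C" "a \<in> T"
  shows "u (\<beta> c a) = (u 0 + u (Suc 0)) / 2 + (- 1) ^ \<beta> c a * ((u 0 - u (Suc 0)) / 2 :: real)"
  using code_bit[OF assms] by (auto simp: field_simps)

lemma mean_code:
  assumes "a \<in> T"
  shows "mean C (\<lambda>c. u (\<beta> c a)) = (u 0 + u (Suc 0)) / 2"
proof -
  have "mean C (\<lambda>c. u (\<beta> c a))
      = mean C (\<lambda>c. (u 0 + u (Suc 0)) / 2 + (u 0 - u (Suc 0)) / 2 * (- 1) ^ \<beta> c a)"
    using assms by (intro mean_cong) (subst code_split[of _ a u], auto)
  then show ?thesis
    by (simp only: mean_add mean_cmult balanced[OF assms] mean_const[OF finite_C C_nonempty])
qed

lemma mean_code_pair:
  assumes "a \<in> T" "b \<in> T" "a \<noteq> b"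
  shows "mean C (\<lambda>c. u (\<beta> c a) * w (\<beta> c b)) = (u 0 + u (Suc 0)) / 2 * ((w 0 + w (Suc 0)) / 2)"
proof -
  let ?u = "(u 0 + u (Suc 0)) / 2" and ?u' = "(u 0 - u (Suc 0)) / 2"
  let ?w = "(w 0 + w (Suc 0)) / 2" and ?w' = "(w 0 - w (Suc 0)) / 2"
  have "mean C (\<lambda>c. u (\<beta> c a) * w (\<beta> c b))
      = mean C (\<lambda>c. ?u * ?w + (?u' * ?w) * (- 1) ^ \<beta> c a + (?u * ?w') * (- 1) ^ \<beta> c b
          + (?u' * ?w') * ((- 1) ^ \<beta> c a * (- 1) ^ \<beta> c b))"
  proof (intro mean_cong)
    fix c assume "c \<in> C"
    show "u (\<beta> c a) * w (\<beta> c b) = ?u * ?w + (?u' * ?w) * (- 1) ^ \<beta> c a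
        + (?u * ?w') * (- 1) ^ \<beta> c b + (?u' * ?w') * ((- 1) ^ \<beta> c a * (- 1) ^ \<beta> c b)"
      unfolding code_split[OF \<open>c \<in> C\<close> assms(1), of u] code_split[OF \<open>c \<in> C\<close> assms(2), of w]
      by (simp only: distrib_left distrib_right mult_ac add_ac)
  qed
  then show ?thesis
    by (simp only: mean_add mean_cmult balanced[OF assms(1)] balanced[OF assms(2)]
        uncorrelated[OF assms] mean_const[OF finite_C C_nonempty])
qed

text \<open>The product is expanded over the set \<open>X\<close> of factors contributing
  \<open>A\<close>. \<open>X = T\<close> is the main term. If one or two factors contribute
  \<open>B\<close>, the mean of the signs vanishes; otherwise at least three values of
  \<open>B\<close> occur.\<close>

lemma code_product_bound:
  assumes A: "\<And>a. a \<in> T \<Longrightarrow> \<bar>A a\<bar> \<le> 1" and B: "\<And>a. a \<in> T \<Longrightarrow> \<bar>B a\<bar> \<le> 1"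
  shows "\<bar>mean C (\<lambda>c. \<Prod>a\<in>T. A a + (- 1) ^ \<beta> c a * B a) - (\<Prod>a\<in>T. A a)\<bar>
       \<le> 2 ^ card T * (\<Sum>(a, b, c)\<in>triples. \<bar>B a * B b * B c\<bar>)"
proof -
  let ?S = "\<Sum>(a, b, c)\<in>triples. \<bar>B a * B b * B c\<bar>"
  define t where "t X = (\<Prod>a\<in>X. A a) * (\<Prod>a\<in>T-X. B a) * mean C (\<lambda>c. \<Prod>a\<in>T-X. (- 1) ^ \<beta> c a)" for X
  have S0: "0 \<le> ?S" by (intro sum_nonneg) auto
  have "mean C (\<lambda>c. \<Prod>a\<in>T. A a + (- 1) ^ \<beta> c a * B a)
      = mean C (\<lambda>c. \<Sum>X\<in>Pow T. ((\<Prod>a\<in>X. A a) * (\<Prod>a\<in>T-X. B a)) * (\<Prod>a\<in>T-X. (- 1) ^ \<beta> c a))"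
    by (subst prod_add[OF finite_T]) (simp add: prod.distrib mult_ac)
  also have "\<dots> = (\<Sum>X\<in>Pow T. t X)"
    by (simp only: mean_sum mean_cmult t_def)
  also have "\<dots> = t T + (\<Sum>X\<in>Pow T - {T}. t X)"
    by (intro sum.remove) (auto simp: finite_T)
  also have "t T = (\<Prod>a\<in>T. A a)"
    by (simp add: t_def mean_const finite_C C_nonempty)
  finally have "\<bar>mean C (\<lambda>c. \<Prod>a\<in>T. A a + (- 1) ^ \<beta> c a * B a) - (\<Prod>a\<in>T. A a)\<bar>
      \<le> (\<Sum>X\<in>Pow T - {T}. \<bar>t X\<bar>)"
    by simp
  also have "\<dots> \<le> (\<Sum>X\<in>Pow T - {T}. ?S)"
  proof (intro sum_mono)
    fix X assume X: "X \<in> Pow T - {T}"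
    define U where "U = T - X"
    have U: "finite U" "U \<subseteq> T" "U \<noteq> {}" using X finite_T by (auto simp: U_def)
    have le1: "\<bar>\<Prod>a\<in>Y. g a\<bar> \<le> 1" if "Y \<subseteq> T" "\<And>a. a \<in> T \<Longrightarrow> \<bar>g a\<bar> \<le> (1::real)" for Y g
      unfolding abs_prod using that by (intro prod_le_1) auto
    consider "card U = 1" | "card U = 2" | "card U \<ge> 3"
      using U by (cases "card U = 0") fastforce+
    then show "\<bar>t X\<bar> \<le> ?S"
    proof cases
      case 1
      then obtain a where "U = {a}" by (auto simp: card_1_singleton_iff)
      then show ?thesis using U S0 balanced by (simp add: t_def flip: U_def)
    next
      case 2
      then obtain a b where "U = {a, b}" "a \<noteq> b" by (auto simp: card_2_iff)
      then show ?thesis using U S0 uncorrelated by (simp add: t_def flip: U_def)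
    next
      case 3
      then obtain V where "V \<subseteq> U" "card V = 3"
        by (meson obtain_subset_with_card_n)
      then obtain a b c where abc: "{a, b, c} \<subseteq> U" "a \<noteq> b" "a \<noteq> c" "b \<noteq> c"
        by (auto simp: card_3_iff)
      have "\<bar>mean C (\<lambda>c. \<Prod>a\<in>U. (- 1) ^ \<beta> c a)\<bar> \<le> mean C (\<lambda>c. 1)"
        by (rule order_trans[OF abs_mean_le]) (intro mean_mono, simp add: abs_prod)
      then have m: "\<bar>mean C (\<lambda>c. \<Prod>a\<in>U. (- 1) ^ \<beta> c a)\<bar> \<le> 1"
        by (simp add: mean_const finite_C C_nonempty)
      \<comment> \<open>Three of the derivatives are kept and the remaining ones are bounded by
        \<open>1\<close>.\<close>
      have "(\<Prod>a\<in>U. B a) = (\<Prod>a\<in>{a, b, c}. B a) * (\<Prod>a\<in>U - {a, b, c}. B a)"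
        using prod.subset_diff[OF abc(1) U(1), of B] by (simp add: mult.commute)
      then have p: "\<bar>\<Prod>a\<in>U. B a\<bar> \<le> \<bar>B a * B b * B c\<bar>"
        using abc(2-) mult_left_le[OF le1[of "U - {a, b, c}" B], of "\<bar>B a * B b * B c\<bar>"] U(2) B
        by (simp add: abs_mult mult.assoc subset_iff)
      have "\<bar>t X\<bar> = \<bar>\<Prod>a\<in>X. A a\<bar> * \<bar>\<Prod>a\<in>U. B a\<bar> * \<bar>mean C (\<lambda>c. \<Prod>a\<in>U. (- 1) ^ \<beta> c a)\<bar>"
        by (simp add: t_def abs_mult U_def)
      also have "\<dots> \<le> 1 * \<bar>B a * B b * B c\<bar> * 1"
        using X le1[of X A] A p m by (intro mult_mono) auto
      also have "\<dots> = (\<lambda>(a, b, c). \<bar>B a * B b * B c\<bar>) (a, b, c)" by simp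
      also have "\<dots> \<le> ?S"
      proof (rule member_le_sum)
        show "(a, b, c) \<in> triples" using abc U(2) by (auto simp: triples_def)
      qed (auto simp: finite_triples)
      finally show ?thesis .
    qed
  qed
  also have "\<dots> \<le> 2 ^ card T * ?S"
  proof -
    have "card (Pow T - {T}) \<le> 2 ^ card T"
      using card_mono[of "Pow T" "Pow T - {T}"] by (auto simp: card_Pow finite_T)
    then have "real (card (Pow T - {T})) \<le> 2 ^ card T"
      by (metis of_nat_le_iff of_nat_numeral of_nat_power)
    then show ?thesis using S0 by (simp add: mult_right_mono)
  qed
  finally show ?thesis .
qed

text \<open>In the application \<open>p\<close>, \<open>r\<close> and \<open>u a i\<close> are the
  noisy influences of the even part, the odd part and the restriction to \<open>i\<close>;
  \<open>split\<close> is the parallelogram identity. Two of the three correlated factors stay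
  together, since pairwise independence evaluates the mean of their product.\<close>

lemma influence_step:
  assumes T: "a \<in> T" "b \<in> T" "a \<noteq> b" "c \<in> T"
    and nonneg: "\<And>a. 0 \<le> p a" "\<And>a. 0 \<le> r a" "\<And>a i. 0 \<le> u a i"
    and split: "\<And>a. u a 0 + u a (Suc 0) = 2 * (p a + r a)"
  shows "(mean C (\<lambda>d. sqrt (u a (\<beta> d a) * u b (\<beta> d b) * u c (\<beta> d c))) + sqrt (p a * p b * p c)) / 2
       \<le> sqrt ((p a + 3 / 4 * r a) * (p b + 3 / 4 * r b) * (p c + 3 / 4 * r c))"
proof -
  \<comment> \<open>Index \<open>0\<close> stands for the independent bits, index \<open>1\<close>
    for the codeword letters.\<close>
  define x y where "x i = (if i = 0 then p a * p b else (p a + r a) * (p b + r b))"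
    and "y i = (if i = 0 then p c else p c + r c)" for i :: nat
  have xy: "0 \<le> x i" "0 \<le> y i" for i using nonneg by (auto simp: x_def y_def)
  define M where "M = mean C (\<lambda>d. sqrt (u a (\<beta> d a) * u b (\<beta> d b)) * sqrt (u c (\<beta> d c)))"
  \<comment> \<open>Cauchy-Schwarz over the codewords separates \<open>c\<close> from the pair
    \<open>a\<close>, \<open>b\<close>; below it is applied again over the coin.\<close>
  have "M\<^sup>2 \<le> mean C (\<lambda>d. u a (\<beta> d a) * u b (\<beta> d b)) * mean C (\<lambda>d. u c (\<beta> d c))"
    using mean_Cauchy_Schwarz[of C "\<lambda>d. sqrt (u a (\<beta> d a) * u b (\<beta> d b))" "\<lambda>d. sqrt (u c (\<beta> d c))"]
    by (simp add: M_def nonneg)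
  also have "\<dots> = x 1 * y 1"
    unfolding mean_code_pair[OF T(1-3), of "u a" "u b"] mean_code[OF T(4), of "u c"] split
    by (simp add: x_def y_def del: distrib_left_numeral)
  finally have "M \<le> sqrt (x 1 * y 1)" by (rule real_le_rsqrt)
  then have "(M + sqrt (x 0 * y 0)) / 2 \<le> mean {0, Suc 0} (\<lambda>i. sqrt (x i) * sqrt (y i))"
    by (simp add: mean_two real_sqrt_mult)
  also have "\<dots> \<le> sqrt (mean {0, Suc 0} x * mean {0, Suc 0} y)"
    using mean_Cauchy_Schwarz[of "{0, Suc 0}" "\<lambda>i. sqrt (x i)" "\<lambda>i. sqrt (y i)"]
    by (intro real_le_rsqrt) (simp add: xy)
  also have "\<dots> \<le> sqrt ((p a + 3 / 4 * r a) * (p b + 3 / 4 * r b) * (p c + 3 / 4 * r c))"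
  proof (intro real_sqrt_le_mono mult_mono)
    have "0 \<le> p a * r b" "0 \<le> r a * p b" "0 \<le> r a * r b" using nonneg by auto
    \<comment> \<open>The coefficient of \<open>r a * r b\<close> is \<open>1 / 2\<close> on the
      left and \<open>9 / 16\<close> on the right; this is where the noise rate must be at least
      \<open>1 / sqrt 2\<close>.\<close>
    then show "mean {0, Suc 0} x \<le> (p a + 3 / 4 * r a) * (p b + 3 / 4 * r b)"
      by (simp add: mean_two x_def algebra_simps)
    show "mean {0, Suc 0} y \<le> p c + 3 / 4 * r c"
      using nonneg(2)[of c] by (simp add: mean_two y_def)
  qed (use nonneg xy in \<open>auto simp: mean_two\<close>)
  finally show ?thesis
    by (simp add: M_def x_def y_def real_sqrt_mult mult.assoc)
qed

text \<open>Up to the factor \<open>2 ^ card T\<close>, this is the error charged to coordinate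
  \<open>j\<close> when the query points are made independent.\<close>

definition joint_influence :: "nat set \<Rightarrow> (nat \<Rightarrow> vec \<Rightarrow> real) \<Rightarrow> nat \<Rightarrow> real" where
  "joint_influence I f j = (\<Sum>(a, b, c)\<in>triples. sqrt (ninf I j (f a) * ninf I j (f b) * ninf I j (f c)))"

text \<open>Induction on the coordinates. Given coordinate \<open>n\<close>, the codeword case is
  the same problem for restrictions of the functions, the independent case for their even parts.
  Decorrelating \<open>n\<close> itself is \<open>code_product_bound\<close> for the means of the
  restrictions.\<close>

theorem expect_prod_invariance:
  assumes "finite I" and "\<And>a x. a \<in> T \<Longrightarrow> x \<in> bits I \<Longrightarrow> \<bar>f a x\<bar> \<le> 1"
  shows "\<bar>expect I (\<lambda>q. \<Prod>a\<in>T. f a (q a)) - (\<Prod>a\<in>T. mean (bits I) (f a))\<bar>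
       \<le> 2 ^ card T * (\<Sum>j\<in>I. joint_influence I f j)"
  using assms
proof (induction I arbitrary: f)
  case empty
  then show ?case by (simp add: expect_def mean_def point_def)
next
  case (insert n I)
  let ?K = "2 ^ card T :: real"
  define A B where "A a = mean (bits I) (even_part n (f a))"
    and "B a = mean (bits I) (odd_part n (f a))" for a
  define g where "g c a = (\<lambda>x. f a (x(n := \<beta> c a)))" for c a
  define X where "X c = expect I (\<lambda>q. \<Prod>a\<in>T. g c a (q a))" for c
  define Y where "Y = expect I (\<lambda>q. \<Prod>a\<in>T. even_part n (f a) (q a))"
  define N where "N = (\<Sum>(a, b, c)\<in>triples. \<bar>B a * B b * B c\<bar>)"
  have upd: "x(n := b) \<in> bits (insert n I)" if "x \<in> bits I" "b \<in> {0, Suc 0}" for x b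
    using that by (auto simp: PiE_insert_eq)
  have f01: "\<bar>f a (x(n := 0))\<bar> \<le> 1" "\<bar>f a (x(n := Suc 0))\<bar> \<le> 1" if "a \<in> T" "x \<in> bits I" for a x
    by (intro insert.prems upd that; simp)+
  have bdd: "\<bar>even_part n (f a) x\<bar> \<le> 1" "\<bar>odd_part n (f a) x\<bar> \<le> 1" if "a \<in> T" "x \<in> bits I" for a x
    using f01[OF that] by (auto simp: even_part_def odd_part_def abs_if split: if_splits)
  have mean_le1: "\<bar>mean (bits I) h\<bar> \<le> 1" if "\<And>x. x \<in> bits I \<Longrightarrow> \<bar>h x\<bar> \<le> 1" for h
  proof -
    have "\<bar>mean (bits I) h\<bar> \<le> mean (bits I) (\<lambda>x. 1)"
      by (rule order_trans[OF abs_mean_le]) (intro mean_mono that)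
    then show ?thesis
      by (simp add: mean_const finite_bits[OF insert.hyps(1)] bits_nonempty del: PiE_eq_empty_iff)
  qed
  have AB: "\<bar>A a\<bar> \<le> 1" "\<bar>B a\<bar> \<le> 1" if "a \<in> T" for a
    unfolding A_def B_def using that bdd by (auto intro!: mean_le1)
  \<comment> \<open>The bits \<open>z a\<close> are independent, so averaging over them acts on each
    factor separately.\<close>
  have Y: "mean (bits T) (\<lambda>z. expect I (\<lambda>q. \<Prod>a\<in>T. f a ((q a)(n := z a)))) = Y"
    unfolding expect_def Y_def
    by (subst mean_swap, subst mean_prod_PiE) (auto simp: finite_T mean_two even_part_def)
  have E: "expect (insert n I) (\<lambda>q. \<Prod>a\<in>T. f a (q a)) = (mean C X + Y) / 2"
    unfolding expect_insert[OF insert.hyps(2)]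
    using mean_sample[of "\<lambda>e. expect I (\<lambda>q. \<Prod>a\<in>T. f a ((q a)(n := e a)))"]
    by (simp add: Y X_def[abs_def] g_def)
  have Y_le: "\<bar>Y - (\<Prod>a\<in>T. A a)\<bar> \<le> ?K * (\<Sum>j\<in>I. joint_influence I (\<lambda>a. even_part n (f a)) j)"
    unfolding Y_def A_def by (rule insert.IH) (rule bdd)
  have mean_g: "mean (bits I) (g c a) = A a + (- 1) ^ \<beta> c a * B a" if "c \<in> C" "a \<in> T" for c a
  proof -
    have "g c a = (\<lambda>x. even_part n (f a) x + (- 1) ^ \<beta> c a * odd_part n (f a) x)"
      using code_bit[OF that] by (auto simp: g_def even_part_def odd_part_def field_simps)
    then show ?thesis by (simp add: A_def B_def mean_add mean_cmult)
  qed
  have X_le: "\<bar>X c - (\<Prod>a\<in>T. A a + (- 1) ^ \<beta> c a * B a)\<bar> \<le> ?K * (\<Sum>j\<in>I. joint_influence I (g c) j)"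
    if "c \<in> C" for c
  proof -
    have "\<bar>X c - (\<Prod>a\<in>T. mean (bits I) (g c a))\<bar> \<le> ?K * (\<Sum>j\<in>I. joint_influence I (g c) j)"
      unfolding X_def
    proof (rule insert.IH)
      show "\<bar>g c a x\<bar> \<le> 1" if "a \<in> T" "x \<in> bits I" for a x
        unfolding g_def by (intro insert.prems upd that code_bit[OF \<open>c \<in> C\<close>])
    qed
    then show ?thesis using that by (simp add: mean_g)
  qed
  have mX: "\<bar>mean C X - (\<Prod>a\<in>T. A a)\<bar> \<le> ?K * (\<Sum>j\<in>I. mean C (\<lambda>c. joint_influence I (g c) j)) + ?K * N"
  proof -
    have "\<bar>mean C X - mean C (\<lambda>c. \<Prod>a\<in>T. A a + (- 1) ^ \<beta> c a * B a)\<bar>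
        \<le> mean C (\<lambda>c. ?K * (\<Sum>j\<in>I. joint_influence I (g c) j))"
      unfolding mean_diff[symmetric]
      by (rule order_trans[OF abs_mean_le]) (intro mean_mono X_le)
    moreover have "\<bar>mean C (\<lambda>c. \<Prod>a\<in>T. A a + (- 1) ^ \<beta> c a * B a) - (\<Prod>a\<in>T. A a)\<bar> \<le> ?K * N"
      unfolding N_def by (rule code_product_bound) (use AB in auto)
    ultimately show ?thesis by (simp add: mean_cmult mean_sum)
  qed
  have "\<bar>expect (insert n I) (\<lambda>q. \<Prod>a\<in>T. f a (q a)) - (\<Prod>a\<in>T. A a)\<bar>
      \<le> ?K * ((\<Sum>j\<in>I. (mean C (\<lambda>c. joint_influence I (g c) j)
            + joint_influence I (\<lambda>a. even_part n (f a)) j) / 2) + N / 2)"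
  proof -
    have "\<bar>(mean C X + Y) / 2 - P\<bar> \<le> (\<bar>mean C X - P\<bar> + \<bar>Y - P\<bar>) / 2" for P
      by (auto simp: abs_if field_simps)
    then have "\<bar>(mean C X + Y) / 2 - (\<Prod>a\<in>T. A a)\<bar>
        \<le> (\<bar>mean C X - (\<Prod>a\<in>T. A a)\<bar> + \<bar>Y - (\<Prod>a\<in>T. A a)\<bar>) / 2" .
    also have "\<dots> \<le> (?K * (\<Sum>j\<in>I. mean C (\<lambda>c. joint_influence I (g c) j)) + ?K * N
        + ?K * (\<Sum>j\<in>I. joint_influence I (\<lambda>a. even_part n (f a)) j)) / 2"
      by (intro divide_right_mono add_mono mX Y_le) simp
    finally show ?thesis
      unfolding E by (simp add: sum.distrib sum_divide_distrib[symmetric] field_simps)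
  qed
  \<comment> \<open>For \<open>j\<close> in \<open>I\<close>, \<open>influence_step\<close>
    recombines the errors of the two cases; \<open>N / 2\<close> is charged to coordinate
    \<open>n\<close>.\<close>
  also have "\<dots> \<le> ?K * ((\<Sum>j\<in>I. joint_influence (insert n I) f j) + joint_influence (insert n I) f n)"
  proof (intro mult_left_mono add_mono sum_mono)
    fix j assume "j \<in> I"
    have "(mean C (\<lambda>d. sqrt (ninf I j (g d a) * ninf I j (g d b) * ninf I j (g d c)))
        + sqrt (ninf I j (even_part n (f a)) * ninf I j (even_part n (f b)) * ninf I j (even_part n (f c)))) / 2
        \<le> sqrt (ninf (insert n I) j (f a) * ninf (insert n I) j (f b) * ninf (insert n I) j (f c))"
      if "(a, b, c) \<in> triples" for a b c
      using that influence_step[of a b c "\<lambda>a. ninf I j (even_part n (f a))"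
          "\<lambda>a. ninf I j (odd_part n (f a))" "\<lambda>a i. ninf I j (\<lambda>x. f a (x(n := i)))"]
        ninf_parallelogram[OF insert.hyps(1)] ninf_insert[OF insert.hyps \<open>j \<in> I\<close>]
      by (simp add: triples_def ninf_nonneg g_def)
    then have "(\<Sum>(a, b, c)\<in>triples. (mean C (\<lambda>d. sqrt (ninf I j (g d a) * ninf I j (g d b) * ninf I j (g d c)))
        + sqrt (ninf I j (even_part n (f a)) * ninf I j (even_part n (f b)) * ninf I j (even_part n (f c)))) / 2)
        \<le> joint_influence (insert n I) f j"
      unfolding joint_influence_def by (intro sum_mono) auto
    then show "(mean C (\<lambda>c. joint_influence I (g c) j) + joint_influence I (\<lambda>a. even_part n (f a)) j) / 2
        \<le> joint_influence (insert n I) f j"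
      unfolding joint_influence_def mean_sum case_prod_beta
      by (simp add: sum.distrib flip: sum_divide_distrib)
  next
    have "\<bar>B a * B b * B c\<bar> / 2
        \<le> sqrt (ninf (insert n I) n (f a) * ninf (insert n I) n (f b) * ninf (insert n I) n (f c))" for a b c
    proof (intro real_le_rsqrt)
      have "(\<bar>B a * B b * B c\<bar> / 2)\<^sup>2 = 1 / 4 * ((B a)\<^sup>2 * (B b)\<^sup>2 * (B c)\<^sup>2)"
        by (simp add: power_divide power_mult_distrib)
      \<comment> \<open>\<open>27 / 64\<close> is \<open>(3 / 4) ^ 3\<close>, one factor for each
        use of \<open>ninf_insert_self\<close>; the \<open>1 / 4\<close> comes from the fair coin
        and leaves room for it.\<close>
      also have "\<dots> \<le> 27 / 64 * ((B a)\<^sup>2 * (B b)\<^sup>2 * (B c)\<^sup>2)"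
        by (intro mult_right_mono) auto
      also have "\<dots> = (3 / 4 * (B a)\<^sup>2) * (3 / 4 * (B b)\<^sup>2) * (3 / 4 * (B c)\<^sup>2)" by simp
      also have "\<dots> \<le> ninf (insert n I) n (f a) * ninf (insert n I) n (f b) * ninf (insert n I) n (f c)"
        unfolding B_def using ninf_insert_self[OF insert.hyps]
        by (intro mult_mono) (auto intro!: mult_nonneg_nonneg simp: ninf_nonneg)
      finally show "(\<bar>B a * B b * B c\<bar> / 2)\<^sup>2
          \<le> ninf (insert n I) n (f a) * ninf (insert n I) n (f b) * ninf (insert n I) n (f c)" .
    qed
    then show "N / 2 \<le> joint_influence (insert n I) f n"
      unfolding N_def joint_influence_def sum_divide_distrib by (intro sum_mono) auto
  qed auto
  finally show ?case
    using insert.hyps by (simp add: A_def mean_bits_insert add.commute)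
qed

end

subsection \<open>Folded functions and low-degree influences\<close>

text \<open>The mean of a character is a product over the coordinates, with factor \<open>0\<close>
  at \<open>j\<close>.\<close>

lemma coef_const:
  assumes "finite I" "j \<in> I" "\<alpha> j = Suc 0"
  shows "coef I (\<lambda>x. c) \<alpha> = 0"
proof -
  have "mean (bits I) (\<lambda>x. (- 1) ^ (\<Sum>i\<in>I. \<alpha> i * x i))
      = (\<Prod>i\<in>I. mean {0, Suc 0} (\<lambda>b. (- 1) ^ (\<alpha> i * b)))"
    using mean_prod_PiE[OF assms(1), of "\<lambda>_. {0, Suc 0}" "\<lambda>i b. (- 1) ^ (\<alpha> i * b)"]
    by (simp add: power_sum)
  also have "\<dots> = 0"
    using assms by (intro prod_zero) (auto simp: mean_two intro!: bexI[of _ j])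
  finally show ?thesis by (simp add: coef_def mean_cmult)
qed

text \<open>The constant does not affect coefficients with \<open>\<alpha> j = 1\<close>, and
  halving divides their squares by \<open>4\<close>. For values \<open>1\<close> and
  \<open>- 1\<close> of \<open>f\<close>, the new function indicates that \<open>f\<close> equals
  \<open>s\<close>.\<close>

lemma ninf_affine_le:
  assumes "finite I" "j \<in> I" "s\<^sup>2 = 1"
  shows "ninf I j (\<lambda>x. (1 + s * f x) / 2) \<le> ninf I j f"
  unfolding ninf_def
proof (intro sum_mono mult_left_mono)
  fix \<alpha> assume \<alpha>: "\<alpha> \<in> {\<alpha> \<in> bits I. \<alpha> j = Suc 0}"
  have "coef I (\<lambda>x. (1 + s * f x) / 2) \<alpha> = coef I (\<lambda>x. 1 / 2 + s / 2 * f x) \<alpha>"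
    by (simp add: add_divide_distrib)
  also have "\<dots> = coef I (\<lambda>x. 1 / 2) \<alpha> + s / 2 * coef I f \<alpha>"
    by (simp only: coef_add) (simp only: coef_def mult.assoc mean_cmult)
  also have "coef I (\<lambda>x. 1 / 2) \<alpha> = 0"
    using \<alpha> assms by (intro coef_const) auto
  finally have "(coef I (\<lambda>x. (1 + s * f x) / 2) \<alpha>)\<^sup>2 = s\<^sup>2 * (coef I f \<alpha>)\<^sup>2 / 4"
    by (simp add: power_mult_distrib power_divide del: eq_divide_eq_numeral1)
  then show "(coef I (\<lambda>x. (1 + s * f x) / 2) \<alpha>)\<^sup>2 \<le> (coef I f \<alpha>)\<^sup>2"
    using zero_le_power2[of "coef I f \<alpha>"] unfolding assms(3) by linarith
qed auto

lemma cube_eq_bits: "cube n = bits {Suc 0..n}"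
  by (simp add: cube_def)

text \<open>Adding the all-ones vector is an involution of the cube that negates
  \<open>f\<close>.\<close>

lemma mean_folded:
  assumes "folded n f"
  shows "mean (bits {Suc 0..n}) f = 0"
proof -
  have "vadd n (ones n) (vadd n (ones n) x) = x" if "x \<in> cube n" for x
  proof
    fix i
    show "vadd n (ones n) (vadd n (ones n) x) i = x i"
      using that PiE_mem[of x "{1..n}" "\<lambda>_. {0, 1}" i] PiE_arb[of x "{1..n}" "\<lambda>_. {0, 1}" i]
      by (cases "i \<in> {1..n}") (auto simp: vadd_def ones_def cube_def)
  qed
  moreover have "vadd n (ones n) x \<in> cube n" for x
    by (auto simp: vadd_def ones_def cube_def)
  ultimately have "bij_betw (vadd n (ones n)) (cube n) (cube n)"
    by (intro bij_betw_byWitness[where f' = "vadd n (ones n)"]) auto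
  then have "mean (cube n) f = mean (cube n) (\<lambda>x. f (vadd n (ones n) x))"
    by (rule mean_bij_betw[symmetric])
  also have "\<dots> = mean (cube n) (\<lambda>x. - 1 * f x)"
    using assms by (intro mean_cong) (simp add: folded_def)
  also have "\<dots> = - 1 * mean (cube n) f"
    by (rule mean_cmult)
  finally have "mean (cube n) f = 0" by linarith
  then show ?thesis by (simp add: cube_eq_bits)
qed

lemma ninf_le_low_influence:
  assumes "f \<in> cube n \<rightarrow> {- 1, 1}"
  shows "ninf {Suc 0..n} i f \<le> low_influence n w i f + (3 / 4) ^ w"
proof -
  have "fourier n f \<alpha> = coef {1..n} f \<alpha>" for \<alpha>
    by (simp add: fourier_def coef_def chi_def mean_def cube_eq_bits)
  then have "low_influence n w i f
      = (\<Sum>\<alpha> | \<alpha> \<in> bits {1..n} \<and> \<alpha> i = Suc 0 \<and> size_of {1..n} \<alpha> \<le> w. (coef {1..n} f \<alpha>)\<^sup>2)"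
    by (simp add: low_influence_def cube_eq_bits weight_def size_of_def)
  moreover have "\<bar>f x\<bar> \<le> 1" if "x \<in> bits {Suc 0..n}" for x
    using Pi_mem[OF assms, of x] that by (auto simp: cube_eq_bits)
  ultimately show ?thesis
    using ninf_le_low_degree[of "{Suc 0..n}" f i w] by simp
qed

text \<open>A factor below \<open>\<delta>\<close> is split off and the other two are bounded by the
  arithmetic-geometric mean inequality. The result is linear in the influences, so that
  \<open>sum_ninf_le\<close> can be applied after summing over coordinates.\<close>

lemma sqrt_triple_le:
  fixes x y z \<delta> :: real
  assumes "0 \<le> x" "0 \<le> y" "0 \<le> z"
    and "x < \<delta> \<or> y < \<delta>" "x < \<delta> \<or> z < \<delta>" "y < \<delta> \<or> z < \<delta>"
  shows "sqrt (x * y * z) \<le> sqrt \<delta> * (x + y + z)"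
proof -
  have *: "sqrt (u * v * w) \<le> sqrt \<delta> * (u + v + w)"
    if "0 \<le> u" "0 \<le> v" "0 \<le> w" "w < \<delta>" for u v w
  proof -
    have "sqrt (u * v) \<le> (u + v) / 2" using that by (intro arith_geo_mean_sqrt)
    also have "\<dots> \<le> u + v + w" using that by simp
    finally have "sqrt w * sqrt (u * v) \<le> sqrt \<delta> * (u + v + w)"
      using that by (intro mult_mono real_sqrt_le_mono) auto
    then show ?thesis by (simp add: real_sqrt_mult mult.commute)
  qed
  show ?thesis
  proof (cases "z < \<delta>")
    case True
    then show ?thesis using *[of x y z] assms by simp
  next
    case False
    then show ?thesis using *[of z x y] assms by (simp add: mult_ac add_ac)
  qed
qed

lemma (in sign_code) sum_joint_influence_le:
  assumes I: "finite I" and bdd: "\<And>a x. a \<in> T \<Longrightarrow> x \<in> bits I \<Longrightarrow> \<bar>f a x\<bar> \<le> 1"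
    and sep: "\<And>a b j. a \<in> T \<Longrightarrow> b \<in> T \<Longrightarrow> a \<noteq> b \<Longrightarrow> j \<in> I \<Longrightarrow>
      ninf I j (f a) < \<delta> \<or> ninf I j (f b) < \<delta>"
    and "0 \<le> \<delta>"
  shows "(\<Sum>j\<in>I. joint_influence I f j) \<le> real (card triples) * 9 * sqrt \<delta>"
proof -
  have "(\<Sum>j\<in>I. joint_influence I f j)
      \<le> (\<Sum>j\<in>I. \<Sum>(a, b, c)\<in>triples. sqrt \<delta> * (ninf I j (f a) + ninf I j (f b) + ninf I j (f c)))"
    unfolding joint_influence_def
  proof (intro sum_mono, clarify)
    fix j a b c assume "j \<in> I" "(a, b, c) \<in> triples"
    then show "sqrt (ninf I j (f a) * ninf I j (f b) * ninf I j (f c))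
        \<le> sqrt \<delta> * (ninf I j (f a) + ninf I j (f b) + ninf I j (f c))"
      by (intro sqrt_triple_le sep ninf_nonneg) (auto simp: triples_def)
  qed
  also have "\<dots> = (\<Sum>(a, b, c)\<in>triples. sqrt \<delta> *
      ((\<Sum>j\<in>I. ninf I j (f a)) + (\<Sum>j\<in>I. ninf I j (f b)) + (\<Sum>j\<in>I. ninf I j (f c))))"
    by (subst sum.swap) (simp add: case_prod_beta sum_distrib_left sum.distrib distrib_left)
  also have "\<dots> \<le> (\<Sum>(a, b, c)\<in>triples. sqrt \<delta> * (3 + 3 + 3))"
    using \<open>0 \<le> \<delta>\<close>
    by (intro sum_mono, clarify, intro mult_left_mono add_mono sum_ninf_le I bdd)
       (auto simp: triples_def)
  finally show ?thesis by (simp add: case_prod_beta mult_ac)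
qed

subsection \<open>The test\<close>

text \<open>All query points are fixed in advance; \<open>u\<close> accumulates the answers on which
  the predicate \<open>P\<close> decides at the leaf.\<close>

primrec ask :: "(nat \<Rightarrow> vec) \<Rightarrow> ((nat \<Rightarrow> real) \<Rightarrow> bool) \<Rightarrow> nat list \<Rightarrow> (nat \<Rightarrow> real) \<Rightarrow> tree" where
  "ask Q P [] u = Verdict (P u)"
| "ask Q P (a # as) u = Query a (Q a) (ask Q P as (u(a := 1))) (ask Q P as (u(a := - 1)))"

lemma accepts_ask:
  assumes "\<And>a. a \<in> set as \<Longrightarrow> f a (Q a) \<in> {- 1, 1}"
  shows "accepts f (ask Q P as u) = P (\<lambda>a. if a \<in> set as then f a (Q a) else u a)"
  using assms
proof (induction as arbitrary: u)
  case (Cons a as)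
  have "accepts f (ask Q P (a # as) u) = accepts f (ask Q P as (u(a := f a (Q a))))"
    using Cons.prems[of a] by auto
  also have "\<dots> = P (\<lambda>b. if b \<in> set as then f b (Q b) else (u(a := f a (Q a))) b)"
    using Cons by simp
  also have "(\<lambda>b. if b \<in> set as then f b (Q b) else (u(a := f a (Q a))) b)
      = (\<lambda>b. if b \<in> set (a # as) then f b (Q b) else u b)"
    by auto
  finally show ?case .
qed simp

lemma wf_tree_ask:
  "wf_tree n t (ask Q P as u)" if "\<And>a. a \<in> set as \<Longrightarrow> a \<in> {1..t} \<and> Q a \<in> cube n"
  using that by (induction as arbitrary: u) auto

lemma tree_queries_ask: "tree_queries (ask Q P as u) (length as)"
  by (induction as arbitrary: u) auto

text \<open>One answer \<open>f 1 x\<close> suffices to build the noise vector; repeating the query only brings the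
  number of queries up to the prescribed value.\<close>

definition pad :: "nat \<Rightarrow> vec \<Rightarrow> tree \<Rightarrow> tree" where
  "pad m x = (\<lambda>U. Query 1 x U U) ^^ m"

lemma accepts_pad: "accepts f (pad m x U) = accepts f U"
  by (induction m) (auto simp: pad_def)

lemma wf_tree_pad: "wf_tree n t U \<Longrightarrow> 1 \<le> t \<Longrightarrow> x \<in> cube n \<Longrightarrow> wf_tree n t (pad m x U)"
  by (induction m) (auto simp: pad_def)

lemma tree_queries_pad: "tree_queries U q \<Longrightarrow> tree_queries (pad m x U) (m + q)"
  by (induction m) (auto simp: pad_def)

locale dictator_code = sign_code T C \<beta> for T and C :: "'c set" and \<beta> +
  fixes t :: nat
  assumes T_eq: "T = {Suc 0..t}" and t_pos: "1 \<le> t"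
begin

text \<open>With \<open>y\<close> the vector of first components, \<open>flip b\<close> turns \<open>y\<close> into the noise vector
  \<open>v = y + b\<close>, where \<open>(- 1) ^ b\<close> is the answer \<open>f 1 y\<close>; for the \<open>i\<close>-th dictator, \<open>v i = 0\<close>.\<close>

definition flip :: "nat \<Rightarrow> nat \<times> 'c \<times> vec \<Rightarrow> nat \<times> 'c \<times> vec" where
  "flip b s = (case s of (v, c, z) \<Rightarrow> ((v + b) mod 2, c, z))"

definition seed :: "nat \<Rightarrow> (nat \<Rightarrow> nat \<times> 'c \<times> vec) \<Rightarrow> vec" where
  "seed n \<xi> = (\<lambda>i\<in>{Suc 0..n}. fst (\<xi> i))"

text \<open>Restricting the flipped samples to \<open>{Suc 0..n}\<close> keeps them in the sample
  space, as the change of variables in \<open>mean_qpoint\<close> requires.\<close>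

definition qpoint :: "nat \<Rightarrow> nat \<Rightarrow> (nat \<Rightarrow> nat \<times> 'c \<times> vec) \<Rightarrow> nat \<Rightarrow> vec" where
  "qpoint n b \<xi> = point {Suc 0..n} (\<lambda>i\<in>{Suc 0..n}. flip b (\<xi> i))"

definition codeword :: "(nat \<Rightarrow> real) \<Rightarrow> bool" where
  "codeword u \<longleftrightarrow> (\<exists>c\<in>C. \<forall>a\<in>T. u a = (- 1) ^ \<beta> c a)"

text \<open>The default \<open>0\<close> is overwritten at every index in \<open>T\<close>, the only
  indices that \<open>codeword\<close> reads.\<close>

definition branch :: "nat \<Rightarrow> (nat \<Rightarrow> nat \<times> 'c \<times> vec) \<Rightarrow> nat \<Rightarrow> tree" where
  "branch n \<xi> b = ask (qpoint n b \<xi>) codeword [1..<Suc t] (\<lambda>_. 0)"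

definition test_tree :: "nat \<Rightarrow> nat \<Rightarrow> (nat \<Rightarrow> nat \<times> 'c \<times> vec) \<Rightarrow> tree" where
  "test_tree m n \<xi> = pad m (seed n \<xi>) (Query 1 (seed n \<xi>) (branch n \<xi> 0) (branch n \<xi> (Suc 0)))"

definition space_of :: "nat \<Rightarrow> (nat \<Rightarrow> nat \<times> 'c \<times> vec) set" where
  "space_of n = PiE {Suc 0..n} (\<lambda>_. sample)"

definition test :: "nat \<Rightarrow> nat \<Rightarrow> tree pmf" where
  "test m n = map_pmf (test_tree m n) (pmf_of_set (space_of n))"

section \<open>Query count, well-formedness and completeness\<close>

lemma finite_space: "finite (space_of n)"
  unfolding space_of_def by (intro finite_PiE) (auto simp: sample_def finite_C finite_bits finite_T)

lemma space_nonempty: "space_of n \<noteq> {}"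
  using C_nonempty by (auto simp: space_of_def PiE_eq_empty_iff sample_def)

lemma set_test: "set_pmf (test m n) = test_tree m n ` space_of n"
  by (simp add: test_def set_pmf_of_set finite_space space_nonempty)

lemma accept_prob_test:
  "accept_prob (test m n) f = mean (space_of n) (\<lambda>\<xi>. of_bool (accepts f (test_tree m n \<xi>)))"
  by (simp add: accept_prob_def test_def measure_pmf_of_set finite_space space_nonempty mean_def
      Int_def)

lemma flip_sample: "s \<in> sample \<Longrightarrow> flip b s \<in> sample"
  by (auto simp: flip_def sample_def)

lemma seed_cube: "\<xi> \<in> space_of n \<Longrightarrow> seed n \<xi> \<in> cube n"
  by (fastforce simp: space_of_def seed_def cube_def sample_def PiE_iff)

lemma sample_bit_range:
  "s \<in> sample \<Longrightarrow> a \<in> T \<Longrightarrow> sample_bit s a \<in> {0, Suc 0}"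
  using code_bit[of "fst (snd s)" a] by (auto simp: sample_def sample_bit_def dest: PiE_mem)

lemma qpoint_cube:
  assumes "\<xi> \<in> space_of n" "a \<in> T"
  shows "qpoint n b \<xi> a \<in> cube n"
proof -
  have "sample_bit (flip b (\<xi> i)) a \<in> {0, Suc 0}" if "i \<in> {Suc 0..n}" for i
    using assms that by (intro sample_bit_range flip_sample) (auto simp: space_of_def)
  then show ?thesis by (simp add: qpoint_def point_def cube_def PiE_iff)
qed

lemma accepts_branch:
  assumes "oracles n t f" "\<xi> \<in> space_of n"
  shows "accepts f (branch n \<xi> b) \<longleftrightarrow> codeword (\<lambda>a. f a (qpoint n b \<xi> a))"
proof -
  have set: "set [1..<Suc t] = T" by (auto simp: T_eq)
  have "f a (qpoint n b \<xi> a) \<in> {- 1, 1}" if "a \<in> set [1..<Suc t]" for a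
  proof -
    have "a \<in> T" using that set by auto
    then have "f a \<in> cube n \<rightarrow> {- 1, 1}" "qpoint n b \<xi> a \<in> cube n"
      using assms qpoint_cube by (auto simp: oracles_def T_eq)
    then show ?thesis by (rule Pi_mem)
  qed
  then have "accepts f (branch n \<xi> b)
      \<longleftrightarrow> codeword (\<lambda>a. if a \<in> set [1..<Suc t] then f a (qpoint n b \<xi> a) else 0)"
    using accepts_ask[of "[1..<Suc t]" f "qpoint n b \<xi>" codeword "\<lambda>_. 0"]
    by (simp only: branch_def)
  then show ?thesis by (simp only: set) (simp add: codeword_def)
qed

lemma accepts_test_tree:
  assumes "oracles n t f" "\<xi> \<in> space_of n"
  shows "accepts f (test_tree m n \<xi>)
     \<longleftrightarrow> codeword (\<lambda>a. f a (qpoint n (if f 1 (seed n \<xi>) = 1 then 0 else Suc 0) \<xi> a))"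
  using accepts_branch[OF assms] by (simp add: test_tree_def accepts_pad)

lemma makes_queries_test: "makes_queries (test m) (m + Suc t)"
proof -
  have "tree_queries (branch n \<xi> b) t" for n \<xi> b
    using tree_queries_ask[of "qpoint n b \<xi>" codeword "[1..<Suc t]" "\<lambda>_. 0"] by (simp add: branch_def del: upt_Suc)
  then have "tree_queries (test_tree m n \<xi>) (m + Suc t)" for n \<xi>
    unfolding test_tree_def by (intro tree_queries_pad) simp
  then show ?thesis by (auto simp: makes_queries_def set_test)
qed

lemma wf_test:
  assumes "U \<in> set_pmf (test m n)"
  shows "wf_tree n t U"
proof -
  obtain \<xi> where \<xi>: "\<xi> \<in> space_of n" "U = test_tree m n \<xi>"
    using assms by (auto simp: set_test)
  have "wf_tree n t (branch n \<xi> b)" for b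
    unfolding branch_def using qpoint_cube[OF \<xi>(1)] by (intro wf_tree_ask) (auto simp: T_eq)
  then show ?thesis
    using \<xi> t_pos seed_cube by (auto simp: test_tree_def intro!: wf_tree_pad)
qed

lemma completeness: "has_completeness t (test m) 1"
  unfolding has_completeness_def
proof (intro allI impI)
  fix n f
  assume or: "oracles n t f"
    and "\<exists>i\<in>{1..n}. \<forall>a\<in>{1..t}. \<forall>x\<in>cube n. f a x = dictator i x"
  then obtain i where i: "i \<in> {Suc 0..n}" and f: "\<And>a x. a \<in> T \<Longrightarrow> x \<in> cube n \<Longrightarrow> f a x = (- 1) ^ x i"
    by (auto simp: dictator_def T_eq)
  have "accepts f (test_tree m n \<xi>)" if \<xi>: "\<xi> \<in> space_of n" for \<xi>
  proof -
    obtain v c z where s: "\<xi> i = (v, c, z)" "v \<in> {0, Suc 0}" "c \<in> C"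
    proof -
      have "\<xi> i \<in> sample" using \<xi> i by (auto simp: space_of_def)
      then show ?thesis using that by (auto simp: sample_def)
    qed
    define b where "b = (if f 1 (seed n \<xi>) = 1 then 0 else Suc 0)"
    have "f 1 (seed n \<xi>) = (- 1) ^ v"
      using f[of 1] seed_cube[OF \<xi>] t_pos i s by (simp add: seed_def T_eq)
    \<comment> \<open>The answer reveals the bit of the seed at the dictator coordinate, so the flip
      clears it and every query point carries its codeword letter there.\<close>
    then have "(v + b) mod 2 = 0"
      using s(2) by (auto simp: b_def)
    then have "qpoint n b \<xi> a i = \<beta> c a" for a
      using i s by (simp add: qpoint_def point_def flip_def sample_bit_def)
    then have "codeword (\<lambda>a. f a (qpoint n b \<xi> a))"
      using s(3) f qpoint_cube[OF \<xi>] by (auto simp: codeword_def)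
    then show ?thesis
      using accepts_test_tree[OF or \<xi>] by (simp add: b_def)
  qed
  then have "accept_prob (test m n) f = mean (space_of n) (\<lambda>\<xi>. 1)"
    unfolding accept_prob_test by (intro mean_cong) simp
  then show "1 \<le> accept_prob (test m n) f"
    by (simp add: mean_const finite_space space_nonempty)
qed

text \<open>For fixed \<open>b\<close>, flipping is an involution of the sample space, so the query
  points have the same joint distribution as without flipping.\<close>

lemma mean_qpoint: "b \<in> {0, Suc 0} \<Longrightarrow> mean (space_of n) (\<lambda>\<xi>. F (qpoint n b \<xi>)) = expect {Suc 0..n} F"
proof -
  assume b: "b \<in> {0, Suc 0}"
  let ?h = "\<lambda>\<xi>. \<lambda>i\<in>{Suc 0..n}. flip b (\<xi> i)"
  have "flip b (flip b s) = s" if "s \<in> sample" for s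
    using that b by (auto simp: flip_def sample_def)
  then have inv: "?h (?h \<xi>) = \<xi>" if "\<xi> \<in> space_of n" for \<xi>
    using that by (fastforce simp: space_of_def PiE_iff extensional_def fun_eq_iff)
  have "?h \<xi> \<in> space_of n" if "\<xi> \<in> space_of n" for \<xi>
    using that flip_sample by (auto simp: space_of_def PiE_iff)
  then have "bij_betw ?h (space_of n) (space_of n)"
    using inv by (intro bij_betw_byWitness[where f' = ?h]) auto
  then show ?thesis
    unfolding qpoint_def expect_def space_of_def[symmetric] by (rule mean_bij_betw)
qed

text \<open>Each product is the indicator that \<open>u\<close> agrees on \<open>T\<close> with the
  codeword \<open>c\<close>; the sum is a union bound over codewords.\<close>

lemma codeword_le:
  assumes "\<And>a. a \<in> T \<Longrightarrow> u a \<in> {- 1, 1}"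
  shows "of_bool (codeword u) \<le> (\<Sum>c\<in>C. \<Prod>a\<in>T. (1 + (- 1) ^ \<beta> c a * u a) / 2 :: real)"
proof -
  have nonneg: "0 \<le> (\<Prod>a\<in>T. (1 + (- 1) ^ \<beta> c a * u a) / 2)" if "c \<in> C" for c
    using assms code_bit[OF that] by (intro prod_nonneg) fastforce
  show ?thesis
  proof (cases "codeword u")
    case True
    then obtain c where c: "c \<in> C" "\<And>a. a \<in> T \<Longrightarrow> u a = (- 1) ^ \<beta> c a"
      by (auto simp: codeword_def)
    then have "1 = (\<Prod>a\<in>T. (1 + (- 1) ^ \<beta> c a * u a) / 2)"
      by (intro prod.neutral[symmetric]) (simp flip: power_add mult_2)
    also have "\<dots> \<le> (\<Sum>c\<in>C. \<Prod>a\<in>T. (1 + (- 1) ^ \<beta> c a * u a) / 2)"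
      using c(1) nonneg finite_C by (intro member_le_sum) auto
    finally show ?thesis using True by simp
  qed (use nonneg in \<open>auto intro: sum_nonneg\<close>)
qed

text \<open>By folding, each agreement indicator has mean \<open>1 / 2\<close>, so independent
  points would match a given codeword with probability \<open>1 / 2 ^ t\<close>; invariance bounds
  the deviation.\<close>

lemma accept_prob_le:
  assumes or: "oracles n t f"
  shows "accept_prob (test m n) f
       \<le> 2 * card C * (1 / 2 ^ t + 2 ^ t * (\<Sum>j\<in>{Suc 0..n}. joint_influence {Suc 0..n} f j))"
proof -
  let ?I = "{Suc 0..n}" and ?J = "\<Sum>j\<in>{Suc 0..n}. joint_influence {Suc 0..n} f j"
  define g where "g c a x = (1 + (- 1) ^ \<beta> c a * f a x) / 2" for c a x
  have card_T: "card T = t" by (simp add: T_eq)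
  have f: "f a x \<in> {- 1, 1}" if "a \<in> T" "x \<in> bits ?I" for a x
    using or that by (auto simp: oracles_def T_eq cube_eq_bits)
  have mean_g: "mean (bits ?I) (g c a) = 1 / 2" if "a \<in> T" for c a
  proof -
    have "mean (bits ?I) (f a) = 0" using or that by (intro mean_folded) (auto simp: oracles_def T_eq)
    then show ?thesis
      by (simp add: g_def[abs_def] mean_divide mean_add mean_cmult mean_const finite_bits
          bits_nonempty del: PiE_eq_empty_iff)
  qed
  have ninf_g: "ninf ?I j (g c a) \<le> ninf ?I j (f a)" if "j \<in> ?I" for j c a
    unfolding g_def[abs_def] using that by (intro ninf_affine_le) (auto simp flip: power_mult)
  have joint_g: "joint_influence ?I (g c) j \<le> joint_influence ?I f j" if "j \<in> ?I" for j c
    unfolding joint_influence_def case_prod_beta using ninf_g[OF that]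
    by (intro sum_mono real_sqrt_le_mono mult_mono mult_nonneg_nonneg ninf_nonneg) auto
  have Eg: "expect ?I (\<lambda>q. \<Prod>a\<in>T. g c a (q a)) \<le> 1 / 2 ^ t + 2 ^ t * ?J" if "c \<in> C" for c
  proof -
    have "\<bar>g c a x\<bar> \<le> 1" if "a \<in> T" "x \<in> bits ?I" for a x
      using f[OF that] code_bit[OF \<open>c \<in> C\<close> that(1)] by (auto simp: g_def)
    then have "\<bar>expect ?I (\<lambda>q. \<Prod>a\<in>T. g c a (q a)) - (\<Prod>a\<in>T. mean (bits ?I) (g c a))\<bar>
        \<le> 2 ^ card T * (\<Sum>j\<in>?I. joint_influence ?I (g c) j)"
      by (intro expect_prod_invariance) auto
    also have "\<dots> \<le> 2 ^ t * ?J"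
      unfolding card_T by (intro mult_left_mono sum_mono joint_g) auto
    finally have "\<bar>expect ?I (\<lambda>q. \<Prod>a\<in>T. g c a (q a)) - 1 / 2 ^ t\<bar> \<le> 2 ^ t * ?J"
      by (simp add: mean_g power_divide card_T)
    then show ?thesis by linarith
  qed
  have pass: "mean (space_of n) (\<lambda>\<xi>. of_bool (codeword (\<lambda>a. f a (qpoint n b \<xi> a))))
      \<le> card C * (1 / 2 ^ t + 2 ^ t * ?J)" if b: "b \<in> {0, Suc 0}" for b
  proof -
    have "mean (space_of n) (\<lambda>\<xi>. of_bool (codeword (\<lambda>a. f a (qpoint n b \<xi> a))))
        \<le> mean (space_of n) (\<lambda>\<xi>. \<Sum>c\<in>C. \<Prod>a\<in>T. g c a (qpoint n b \<xi> a))"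
      unfolding g_def using f qpoint_cube by (intro mean_mono codeword_le) (auto simp: cube_eq_bits)
    also have "\<dots> = (\<Sum>c\<in>C. expect ?I (\<lambda>q. \<Prod>a\<in>T. g c a (q a)))"
      by (simp add: mean_sum mean_qpoint[OF b, of n "\<lambda>q. \<Prod>a\<in>T. g _ a (q a)"])
    also have "\<dots> \<le> (\<Sum>c\<in>C. 1 / 2 ^ t + 2 ^ t * ?J)"
      by (intro sum_mono Eg)
    finally show ?thesis by simp
  qed
  \<comment> \<open>The value of \<open>b\<close> depends on the sample through the first answer;
    adding both possibilities makes it constant, at the cost of the factor \<open>2\<close>.\<close>
  have "accept_prob (test m n) f
      \<le> mean (space_of n) (\<lambda>\<xi>. of_bool (codeword (\<lambda>a. f a (qpoint n 0 \<xi> a)))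
          + of_bool (codeword (\<lambda>a. f a (qpoint n (Suc 0) \<xi> a))))"
    unfolding accept_prob_test by (intro mean_mono) (simp add: accepts_test_tree[OF or])
  then show ?thesis
    using pass[of 0] pass[of "Suc 0"] by (simp add: mean_add)
qed

lemma soundness:
  assumes s: "2 * card C / 2 ^ t \<le> s"
  shows "has_soundness t (test m) s"
  unfolding has_soundness_def
proof (intro allI impI)
  fix \<epsilon> :: real assume "\<epsilon> > 0"
  \<comment> \<open>\<open>K * sqrt \<delta>\<close> is the total error from
    \<open>accept_prob_le\<close> and \<open>sum_joint_influence_le\<close>. The
    \<open>K + 1\<close> in \<open>\<delta>\<close> keeps the denominator positive when
    \<open>K = 0\<close>.\<close>
  define K where "K = 2 * card C * (2 ^ t * (real (card triples) * 9))"
  define \<delta> where "\<delta> = (\<epsilon> / (2 * (K + 1)))\<^sup>2"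
  have "0 \<le> K" by (simp add: K_def)
  then have \<delta>: "0 < \<delta>" "sqrt \<delta> = \<epsilon> / (2 * (K + 1))"
    using \<open>\<epsilon> > 0\<close> by (auto simp: \<delta>_def)
  have K\<delta>: "K * sqrt \<delta> < \<epsilon>"
    unfolding \<delta>(2) using \<open>0 \<le> K\<close> \<open>\<epsilon> > 0\<close> by (simp add: field_simps add_nonneg_pos)
  \<comment> \<open>With threshold \<open>\<delta> / 2\<close> and a tail below
    \<open>\<delta> / 2\<close>, a small low-degree influence forces a noisy influence below
    \<open>\<delta>\<close>. The successor makes the degree positive.\<close>
  obtain w0 where "(3 / 4 :: real) ^ w0 < \<delta> / 2"
    using real_arch_pow_inv[of "\<delta> / 2" "3 / 4"] \<delta>(1) by auto
  then have w: "(3 / 4 :: real) ^ Suc w0 < \<delta> / 2"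
    using power_decreasing[of w0 "Suc w0" "3 / 4 :: real"] by linarith
  show "\<exists>\<tau>>0. \<exists>w\<ge>1. \<forall>n\<ge>1. \<forall>f. oracles n t f \<longrightarrow> accept_prob (test m n) f \<ge> s + \<epsilon> \<longrightarrow>
      (\<exists>a\<in>{1..t}. \<exists>b\<in>{1..t}. \<exists>i\<in>{1..n}. a \<noteq> b \<and>
         low_influence n w i (f a) \<ge> \<tau> \<and> low_influence n w i (f b) \<ge> \<tau>)"
  proof (rule exI[of _ "\<delta> / 2"], intro conjI exI[of _ "Suc w0"] allI impI)
    fix n f assume or: "oracles n t f" and acc: "s + \<epsilon> \<le> accept_prob (test m n) f"
    have f: "f a \<in> cube n \<rightarrow> {- 1, 1}" if "a \<in> T" for a
      using or that by (auto simp: oracles_def T_eq)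
    show "\<exists>a\<in>{1..t}. \<exists>b\<in>{1..t}. \<exists>i\<in>{1..n}. a \<noteq> b \<and>
         \<delta> / 2 \<le> low_influence n (Suc w0) i (f a) \<and> \<delta> / 2 \<le> low_influence n (Suc w0) i (f b)"
    proof (rule ccontr)
      assume no: "\<not> ?thesis"
      have ninf: "ninf {Suc 0..n} i (f a) < \<delta>"
        if "a \<in> T" "low_influence n (Suc w0) i (f a) < \<delta> / 2" for a i
        using ninf_le_low_influence[OF f[OF that(1)], of i "Suc w0"] that(2) w by linarith
      have "(\<Sum>j\<in>{Suc 0..n}. joint_influence {Suc 0..n} f j) \<le> real (card triples) * 9 * sqrt \<delta>"
      proof (rule sum_joint_influence_le)
        show "\<bar>f a x\<bar> \<le> 1" if "a \<in> T" "x \<in> bits {Suc 0..n}" for a x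
          using Pi_mem[OF f[OF that(1)], of x] that(2) by (auto simp: cube_eq_bits)
        show "ninf {Suc 0..n} j (f a) < \<delta> \<or> ninf {Suc 0..n} j (f b) < \<delta>"
          if "a \<in> T" "b \<in> T" "a \<noteq> b" "j \<in> {Suc 0..n}" for a b j
          using no that ninf unfolding T_eq One_nat_def by (metis not_le)
      qed (use \<delta> in auto)
      then have "accept_prob (test m n) f
          \<le> 2 * card C * (1 / 2 ^ t + 2 ^ t * (real (card triples) * 9 * sqrt \<delta>))"
        by (intro order_trans[OF accept_prob_le[OF or]] mult_left_mono add_left_mono) auto
      also have "\<dots> = 2 * card C / 2 ^ t + K * sqrt \<delta>"
        by (simp add: K_def algebra_simps)
      also have "\<dots> < s + \<epsilon>" using s K\<delta> by linarith
      finally show False using acc by simp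
    qed
  qed (use \<delta> in auto)
qed

end

subsection \<open>The Hadamard code\<close>

text \<open>Inner product mod 2 of the vectors with supports \<open>c\<close> and
  \<open>h a\<close>; when \<open>h\<close> enumerates the nonempty sets, this is the Hadamard code
  punctured at the zero vector.\<close>

definition inner_parity :: "(nat \<Rightarrow> nat set) \<Rightarrow> nat set \<Rightarrow> nat \<Rightarrow> nat" where
  "inner_parity h c a = card (c \<inter> h a) mod 2"

lemma inner_parity_sign:
  assumes "finite c"
  shows "(- 1) ^ inner_parity h c a = (\<Prod>i\<in>c. if i \<in> h a then - 1 else 1 :: real)"
proof -
  have "(- 1) ^ inner_parity h c a = (- 1 :: real) ^ card (c \<inter> h a)"
    by (simp add: inner_parity_def minus_one_power_iff)
  also have "\<dots> = (\<Prod>i\<in>c \<inter> h a. - 1)" by simp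
  also have "\<dots> = (\<Prod>i\<in>c. if i \<in> h a then - 1 else 1)"
    by (rule prod.inter_restrict[OF assms])
  finally show ?thesis .
qed

text \<open>The sum over all subsets factors as the product of \<open>w i + 1\<close>.\<close>

lemma mean_Pow_prod_eq_0:
  assumes "finite K" "i \<in> K" "w i = - 1"
  shows "mean (Pow K) (\<lambda>c. \<Prod>i\<in>c. w i) = 0"
proof -
  have "(\<Sum>c\<in>Pow K. \<Prod>i\<in>c. w i) = (\<Prod>i\<in>K. w i + 1)"
    using prod_add[OF assms(1), of w "\<lambda>_. 1"] by simp
  also have "\<dots> = 0"
    using assms by (intro prod_zero) (auto intro!: bexI[of _ i])
  finally show ?thesis by (simp add: mean_def)
qed

text \<open>An element of \<open>h a\<close> gives a sign \<open>- 1\<close> for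
  \<open>balanced\<close>; an element of exactly one of \<open>h a\<close> and \<open>h b\<close>
  gives one for \<open>uncorrelated\<close>.\<close>

lemma dictator_code_Hadamard:
  assumes h: "bij_betw h {Suc 0..t} (Pow {..<k} - {{}})" and "1 \<le> t"
  shows "dictator_code {Suc 0..t} (Pow {..<k}) (inner_parity h) t"
proof unfold_locales
  have sub: "h a \<subseteq> {..<k}" "h a \<noteq> {}" if "a \<in> {Suc 0..t}" for a
    using bij_betwE[OF h] that by auto
  show "inner_parity h c a \<in> {0, Suc 0}" for c a
    by (auto simp: inner_parity_def)
  show "mean (Pow {..<k}) (\<lambda>c. (- 1) ^ inner_parity h c a) = 0" if a: "a \<in> {Suc 0..t}" for a
  proof -
    obtain i where i: "i \<in> h a" using sub[OF a] by auto
    have "mean (Pow {..<k}) (\<lambda>c. (- 1) ^ inner_parity h c a)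
        = mean (Pow {..<k}) (\<lambda>c. \<Prod>i\<in>c. if i \<in> h a then - 1 else 1)"
      by (intro mean_cong inner_parity_sign) (auto intro: finite_subset)
    also have "\<dots> = 0"
      using i sub[OF a] by (intro mean_Pow_prod_eq_0[of _ i]) auto
    finally show ?thesis .
  qed
  show "mean (Pow {..<k}) (\<lambda>c. (- 1) ^ inner_parity h c a * (- 1) ^ inner_parity h c b) = 0"
    if a: "a \<in> {Suc 0..t}" and b: "b \<in> {Suc 0..t}" and "a \<noteq> b" for a b
  proof -
    have "h a \<noteq> h b" using inj_onD[OF bij_betw_imp_inj_on[OF h], of a b] that by blast
    then obtain i where i: "i \<in> h a \<longleftrightarrow> i \<notin> h b" by auto
    have "mean (Pow {..<k}) (\<lambda>c. (- 1) ^ inner_parity h c a * (- 1) ^ inner_parity h c b)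
        = mean (Pow {..<k}) (\<lambda>c. \<Prod>i\<in>c. (if i \<in> h a then - 1 else 1) * (if i \<in> h b then - 1 else 1))"
    proof (intro mean_cong)
      fix c assume "c \<in> Pow {..<k}"
      then have "finite c" by (auto intro: finite_subset)
      then show "(- 1) ^ inner_parity h c a * (- 1) ^ inner_parity h c b
          = (\<Prod>i\<in>c. (if i \<in> h a then - 1 else 1) * (if i \<in> h b then - 1 else 1 :: real))"
        by (simp add: inner_parity_sign prod.distrib)
    qed
    also have "\<dots> = 0"
      using i sub[OF a] sub[OF b] by (intro mean_Pow_prod_eq_0[of _ i]) auto
    finally show ?thesis .
  qed
qed (use assms(2) in auto)

theorem mainTheorem1:
  "infinite {t::nat. t > 0 \<and>
     (\<exists>(q::nat) (D :: nat \<Rightarrow> tree pmf).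
        real q = real t + log 2 (real t + 1) \<and>
        makes_queries D q \<and>
        dictatorship_test t 1 ((real t + 1)\<^sup>2 / 2 ^ t) D)}" (is "infinite ?S")
proof -
  have mem: "2 ^ k - 1 \<in> ?S" if "1 \<le> k" for k :: nat
  proof -
    define t :: nat where "t = 2 ^ k - 1"
    have "2 ^ 1 \<le> (2 :: nat) ^ k" using that by (intro power_increasing) auto
    then have t: "1 \<le> t" "t + 1 = 2 ^ k" by (auto simp: t_def)
    then have t': "real t + 1 = 2 ^ k" by (metis of_nat_1 of_nat_add of_nat_numeral of_nat_power)
    have "card (Pow {..<k} - {{}}) = t"
      by (simp add: card_Diff_subset card_Pow t_def)
    then obtain h where h: "bij_betw h {Suc 0..t} (Pow {..<k} - {{}})"
      using finite_same_card_bij[of "{Suc 0..t}" "Pow {..<k} - {{}}"] by auto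
    interpret dictator_code "{Suc 0..t}" "Pow {..<k}" "inner_parity h" t
      using dictator_code_Hadamard[OF h t(1)] .
    \<comment> \<open>The test achieves \<open>2 * (t + 1) / 2 ^ t\<close>; since
      \<open>t + 1 \<ge> 2\<close>, this is at most the required soundness.\<close>
    have "2 * real (card (Pow {..<k})) \<le> (real t + 1)\<^sup>2"
      using \<open>2 ^ 1 \<le> (2 :: nat) ^ k\<close> unfolding t'
      by (simp add: card_Pow power2_eq_square) (metis of_nat_le_iff of_nat_numeral of_nat_power)
    then have "has_soundness t (test (k - 1)) ((real t + 1)\<^sup>2 / 2 ^ t)"
      by (intro soundness divide_right_mono) auto
    then have "dictatorship_test t 1 ((real t + 1)\<^sup>2 / 2 ^ t) (test (k - 1))"
      by (simp add: dictatorship_test_def wf_test completeness)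
    \<comment> \<open>There are \<open>k - 1\<close> repeated queries, one whose answer is used, and
      \<open>t\<close> codeword queries, where \<open>k\<close> is the logarithm of
      \<open>t + 1\<close>.\<close>
    moreover have "real (k - 1 + Suc t) = real t + log 2 (real t + 1)"
      using that unfolding t' by (simp add: log_nat_power)
    ultimately have "t \<in> ?S"
      using makes_queries_test[of "k - 1"] t(1) by (auto intro!: exI[of _ "k - 1 + Suc t"])
    then show ?thesis by (simp only: t_def)
  qed
  have "inj_on (\<lambda>k::nat. 2 ^ k - 1 :: nat) {1..}"
  proof (rule inj_onI)
    fix k l :: nat assume "2 ^ k - 1 = (2 ^ l - 1 :: nat)"
    moreover have "1 \<le> (2::nat) ^ k" "1 \<le> (2::nat) ^ l" by auto
    ultimately have "(2::nat) ^ k = 2 ^ l" by linarith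
    then show "k = l" by simp
  qed
  then have "infinite ((\<lambda>k::nat. 2 ^ k - 1 :: nat) ` {1..})"
    by (simp add: finite_image_iff infinite_Ici)
  moreover have "(\<lambda>k::nat. 2 ^ k - 1 :: nat) ` {1..} \<subseteq> ?S"
    using mem by blast
  ultimately show ?thesis by (rule infinite_super[rotated])
qed

end
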